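(* Let $H$ be a complex Hilbert space with $\dim H\geq 2$ and let $\phi:E(H)\to E(H)$ be an ortho-order automorphism. Then $\phi$ preserves the order and zero product in both directions, i.e., for all $A,B\in E(H)$, $A\leq B\Longleftrightarrow\phi(A)\leq\phi(B)$ and $AB=0\Longleftrightarrow\phi(A)\phi(B)=0$. In fact, there is an either unitary or antiunitary operator $U$ on $H$ such that \[ \phi(A)=UAU^*\qquad (A\in E(H)). \]
   Context: $E(H)$ denotes the set of all (Hilbert space) effects on $H$, i.e., all positive bounded linear operators $A$ on $H$ with $0\leq A\leq I$, where $I$ is the identity. The order $\leq$ is the usual order among self-adjoint bounded linear operators, and $A'=I-A$ for $A\in E(H)$. A bijective map $\phi:E(H)\to E(H)$ is called an ortho-order automorphism if for any $A,B\in E(H)$ we have $A\leq B\Longleftrightarrow\phi(A)\leq\phi(B)$ and $\phi(A')=\phi(A)'$. *)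

theory Defs
  imports "HOL-Analysis.Analysis"
begin

text \<open>
  Complex Hilbert spaces of arbitrary dimension. The underlying real Hilbert space structure (which
  provides norm and topology) is the one induced by the complex structure: \<open>scaleR\<close> is the
  restriction of \<open>scaleC\<close> and \<open>inner\<close> is the real part of \<open>cinner\<close>, so the norm of \<open>x\<close> is
  the square root of \<open>cinner x x\<close>. The form \<open>cinner\<close> is linear in its first argument.
\<close>

class complex_hilbert_space = real_inner + complete_space +
  fixes scaleC :: "complex \<Rightarrow> 'a \<Rightarrow> 'a" (infixr "*\<^sub>C" 75)
    and cinner :: "'a \<Rightarrow> 'a \<Rightarrow> complex"
  assumes scaleC_add_right: "a *\<^sub>C (x + y) = a *\<^sub>C x + a *\<^sub>C y"
    and scaleC_add_left: "(a + b) *\<^sub>C x = a *\<^sub>C x + b *\<^sub>C x"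
    and scaleC_scaleC: "a *\<^sub>C b *\<^sub>C x = (a * b) *\<^sub>C x"
    and scaleC_one: "1 *\<^sub>C x = x"
    and scaleR_scaleC: "r *\<^sub>R x = complex_of_real r *\<^sub>C x"
    and cinner_commute: "cinner x y = cnj (cinner y x)"
    and cinner_add_left: "cinner (x + y) z = cinner x z + cinner y z"
    and cinner_scaleC_left: "cinner (a *\<^sub>C x) y = a * cinner x y"
    and inner_eq_Re_cinner: "inner x y = Re (cinner x y)"

subclass (in complex_hilbert_space) banach ..

lemma vector_space_scaleC: "vector_space (scaleC :: complex \<Rightarrow> 'a::complex_hilbert_space \<Rightarrow> 'a)"
  by unfold_locales (simp_all add: scaleC_add_right scaleC_add_left scaleC_scaleC scaleC_one)

lemma cinner_self: "cinner x x = complex_of_real ((norm x)\<^sup>2)"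
proof -
  have "Im (cinner x x) = 0"
    using arg_cong[OF cinner_commute[of x x], of Im] by simp
  then show ?thesis
    by (simp add: complex_eq_iff power2_norm_eq_inner inner_eq_Re_cinner)
qed

definition cdim_at_least :: "nat \<Rightarrow> 'a::complex_hilbert_space itself \<Rightarrow> bool" where
  "cdim_at_least n _ \<longleftrightarrow>
     (\<exists>S :: 'a set. finite S \<and> card S = n \<and> \<not> module.dependent scaleC S)"

lemma cdim_at_least_iff_basis:
  fixes B :: "'a::complex_hilbert_space set"
  assumes "\<not> module.dependent scaleC B" and "module.span scaleC B = UNIV"
  shows "cdim_at_least n TYPE('a) \<longleftrightarrow> infinite B \<or> n \<le> card B"
proof -
  interpret vector_space "scaleC :: complex \<Rightarrow> 'a \<Rightarrow> 'a" by (rule vector_space_scaleC)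
  show ?thesis
  proof
    assume "cdim_at_least n TYPE('a)"
    then obtain S :: "'a set" where S: "finite S" "card S = n" "independent S"
      unfolding cdim_at_least_def by blast
    then show "infinite B \<or> n \<le> card B"
      using independent_span_bound[of B S] assms(2) by auto
  next
    assume "infinite B \<or> n \<le> card B"
    then obtain S where "S \<subseteq> B" "finite S" "card S = n"
      by (metis infinite_arbitrarily_large obtain_subset_with_card_n)
    then show "cdim_at_least n TYPE('a)"
      unfolding cdim_at_least_def using assms(1) independent_mono by blast
  qed
qed

text \<open>
  Bounded operators are represented by the library type of real-linear bounded operators; complex
  linearity or conjugate linearity is imposed separately.
\<close>

definition complex_linear_op :: "('a::complex_hilbert_space \<Rightarrow>\<^sub>L 'a) \<Rightarrow> bool" where
  "complex_linear_op A \<longleftrightarrow> (\<forall>a x. A (a *\<^sub>C x) = a *\<^sub>C A x)"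

definition conjugate_linear_op :: "('a::complex_hilbert_space \<Rightarrow>\<^sub>L 'a) \<Rightarrow> bool" where
  "conjugate_linear_op A \<longleftrightarrow> (\<forall>a x. A (a *\<^sub>C x) = cnj a *\<^sub>C A x)"

text \<open>For complex-linear operators, positivity in this sense entails self-adjointness.\<close>

definition positive_op :: "('a::complex_hilbert_space \<Rightarrow>\<^sub>L 'a) \<Rightarrow> bool" where
  "positive_op A \<longleftrightarrow> (\<forall>x. cinner (A x) x \<in> \<real>\<^sub>\<ge>\<^sub>0)"

definition op_le :: "('a::complex_hilbert_space \<Rightarrow>\<^sub>L 'a) \<Rightarrow> ('a \<Rightarrow>\<^sub>L 'a) \<Rightarrow> bool"
    (infix "\<preceq>" 50) where
  "A \<preceq> B \<longleftrightarrow> positive_op (B - A)"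

definition effects :: "('a::complex_hilbert_space \<Rightarrow>\<^sub>L 'a) set" where
  "effects = {A. complex_linear_op A \<and> 0 \<preceq> A \<and> A \<preceq> id_blinfun}"

definition ortho_order_automorphism ::
    "(('a::complex_hilbert_space \<Rightarrow>\<^sub>L 'a) \<Rightarrow> ('a \<Rightarrow>\<^sub>L 'a)) \<Rightarrow> bool" where
  "ortho_order_automorphism \<phi> \<longleftrightarrow>
     bij_betw \<phi> effects effects \<and>
     (\<forall>A\<in>effects. \<forall>B\<in>effects. A \<preceq> B \<longleftrightarrow> \<phi> A \<preceq> \<phi> B) \<and>
     (\<forall>A\<in>effects. \<phi> (id_blinfun - A) = id_blinfun - \<phi> A)"

definition unitary_op :: "('a::complex_hilbert_space \<Rightarrow>\<^sub>L 'a) \<Rightarrow> bool" where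
  "unitary_op U \<longleftrightarrow> complex_linear_op U \<and> surj (blinfun_apply U) \<and>
     (\<forall>x y. cinner (U x) (U y) = cinner x y)"

definition antiunitary_op :: "('a::complex_hilbert_space \<Rightarrow>\<^sub>L 'a) \<Rightarrow> bool" where
  "antiunitary_op U \<longleftrightarrow> conjugate_linear_op U \<and> surj (blinfun_apply U) \<and>
     (\<forall>x y. cinner (U x) (U y) = cnj (cinner x y))"

text \<open>
  Adjoints of complex-linear and of conjugate-linear operators. In the conjugate-linear case the
  defining identity carries a complex conjugation, without which both sides could not have the same
  linearity in \<open>x\<close>.
\<close>

definition adjoint_op :: "('a::complex_hilbert_space \<Rightarrow>\<^sub>L 'a) \<Rightarrow> ('a \<Rightarrow>\<^sub>L 'a)" where
  "adjoint_op A = (THE B :: 'a \<Rightarrow>\<^sub>L 'a. \<forall>x y. cinner (A x) y = cinner x (B y))"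

definition conjugate_adjoint_op :: "('a::complex_hilbert_space \<Rightarrow>\<^sub>L 'a) \<Rightarrow> ('a \<Rightarrow>\<^sub>L 'a)" where
  "conjugate_adjoint_op A = (THE B :: 'a \<Rightarrow>\<^sub>L 'a. \<forall>x y. cinner (A x) y = cnj (cinner x (B y)))"

lemma eq_if_cinner_eq:
  fixes u v :: "'a::complex_hilbert_space"
  assumes "\<And>x. cinner x u = cinner x v"
  shows "u = v"
proof -
  have "inner x u = inner x v" for x
    using assms by (simp add: inner_eq_Re_cinner)
  then have "inner (u - v) (u - v) = 0"
    by (simp add: inner_diff_right)
  then show ?thesis by simp
qed

lemma adjoint_op_eqI:
  assumes "\<And>x y. cinner (blinfun_apply A x) y = cinner x (blinfun_apply B y)"
  shows "adjoint_op A = B"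
  unfolding adjoint_op_def
proof (rule the_equality)
  fix C :: "'a \<Rightarrow>\<^sub>L 'a" assume "\<forall>x y. cinner (A x) y = cinner x (C y)"
  then show "C = B"
    using assms by (intro blinfun_eqI eq_if_cinner_eq) metis
qed (use assms in blast)

lemma conjugate_adjoint_op_eqI:
  assumes "\<And>x y. cinner (blinfun_apply A x) y = cnj (cinner x (blinfun_apply B y))"
  shows "conjugate_adjoint_op A = B"
  unfolding conjugate_adjoint_op_def
proof (rule the_equality)
  fix C :: "'a \<Rightarrow>\<^sub>L 'a" assume "\<forall>x y. cinner (A x) y = cnj (cinner x (C y))"
  then show "C = B"
    using assms by (intro blinfun_eqI eq_if_cinner_eq) (metis complex_cnj_cnj)
qed (use assms in blast)

end

theory Submission imports Defs begin

text \<open>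
  An automorphism \<open>\<phi>\<close> is recovered from its action on the rank-one effects \<open>t P\<close>, where \<open>P\<close> is a
  rank-one projection and \<open>0 < t \<le> 1\<close>.

  Order and complement alone single these out: an effect is a projection iff only \<open>0\<close> lies below
  both it and its complement (\<open>sharp_iff_idempotent\<close>), the rank-one projections are the minimal
  nonzero projections, and the effects below \<open>P\<close> are its multiples. So
  \<open>\<phi> (t P) = t' P'\<close>, where \<open>P'\<close> depends on \<open>P\<close> only and \<open>t'\<close> is an increasing function of \<open>t\<close> that
  might depend on \<open>P\<close>. The interaction of two lines is seen by the relation
  \<open>s P \<preceq> I - t Q\<close>, which \<open>\<phi>\<close> preserves. With \<open>s = 1 / (1 + u)\<close> and \<open>t = 1 / (1 + v)\<close> it reads
  \<open>u v \<ge> c\<close>, where \<open>c = |\<langle>x, y\<rangle>|\<^sup>2\<close> for unit vectors \<open>x\<close> and \<open>y\<close> spanning the ranges of \<open>P\<close> and \<open>Q\<close>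
  (\<open>rank_one_le_complement_iff\<close>). Writing \<open>G\<^sub>P\<close> for the action of \<open>\<phi>\<close> on the parameter \<open>u\<close> of the
  line \<open>P\<close> and \<open>c'\<close> for the transition probability of the image lines, the boundary case yields
  \<open>G\<^sub>P u * G\<^sub>Q (c / u) = c'\<close>.
  This functional equation is very rigid (\<open>weights_rigid\<close>): all the \<open>G\<^sub>P\<close> coincide with one
  monotone multiplicative function \<open>g\<close>, and \<open>c' = g c\<close>. Bessel's inequality for a vector that
  bisects an orthonormal pair, in the source and in the target, gives \<open>g (1/2) = 1/2\<close>, so \<open>g\<close> is the
  identity. This works already in dimension two, where orthogonality of lines by itself carries
  too little information.

  Hence \<open>\<phi> (t P) = t P'\<close>, and \<open>P \<mapsto> P'\<close> preserves transition probabilities. By Wigner's theorem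
  (\<open>Wigner\<close>) it is induced by a unitary or antiunitary \<open>U\<close>. Finally, the form of an effect at a vector
  is attained by a rank-one effect below it (\<open>op_le_if_rank_one_below\<close>), so an effect is determined
  by the rank-one effects below it, and \<open>\<phi> A = U A U\<^sup>*\<close> follows for all \<open>A\<close>. Zero products are
  preserved because \<open>\<phi> A \<phi> B = U A B U\<^sup>*\<close>.
\<close>

section \<open>Complex inner products\<close>

lemma cinner_add_right: "cinner x (y + z) = cinner x y + cinner x (z::'a::complex_hilbert_space)"
  by (metis cinner_commute cinner_add_left complex_cnj_add)

lemma cinner_scaleC_right: "cinner x (a *\<^sub>C y) = cnj a * cinner x (y::'a::complex_hilbert_space)"
  by (metis cinner_commute cinner_scaleC_left complex_cnj_mult)

lemma cinner_scaleR_left: "cinner (r *\<^sub>R x) y = of_real r * cinner x (y::'a::complex_hilbert_space)"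
  by (simp add: scaleR_scaleC cinner_scaleC_left)

lemma cinner_scaleR_right: "cinner x (r *\<^sub>R y) = of_real r * cinner x (y::'a::complex_hilbert_space)"
  by (simp add: scaleR_scaleC cinner_scaleC_right)

lemma cinner_minus_left: "cinner (- x) y = - cinner x (y::'a::complex_hilbert_space)"
  using cinner_scaleR_left[of "-1" x y] by simp

lemma cinner_minus_right: "cinner x (- y) = - cinner x (y::'a::complex_hilbert_space)"
  using cinner_scaleR_right[of x "-1" y] by simp

lemma cinner_diff_left: "cinner (x - y) z = cinner x z - cinner y (z::'a::complex_hilbert_space)"
  using cinner_add_left[of x "-y" z] by (simp add: cinner_minus_left)

lemma cinner_diff_right: "cinner x (y - z) = cinner x y - cinner x (z::'a::complex_hilbert_space)"
  using cinner_add_right[of x y "-z"] by (simp add: cinner_minus_right)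

lemma cinner_zero_left [simp]: "cinner 0 (y::'a::complex_hilbert_space) = 0"
  using cinner_scaleR_left[of 0 0 y] by simp

lemma cinner_zero_right [simp]: "cinner (y::'a::complex_hilbert_space) 0 = 0"
  using cinner_scaleR_right[of y 0 0] by simp

lemmas cinner_expand = cinner_add_left cinner_add_right cinner_diff_left cinner_diff_right
  cinner_scaleC_left cinner_scaleC_right cinner_scaleR_left cinner_scaleR_right
  cinner_minus_left cinner_minus_right

lemma cmod_cinner_commute: "cmod (cinner x y) = cmod (cinner y (x::'a::complex_hilbert_space))"
  by (metis cinner_commute complex_mod_cnj)

lemma scaleC_zero_left [simp]: "0 *\<^sub>C (x::'a::complex_hilbert_space) = 0"
  using scaleR_scaleC[of 0 x] by simp

lemma scaleC_zero_right [simp]: "a *\<^sub>C (0::'a::complex_hilbert_space) = 0"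
  using scaleC_add_right[of a 0 "0::'a"] by simp

lemma scaleC_minus_right: "a *\<^sub>C (- x) = - (a *\<^sub>C (x::'a::complex_hilbert_space))"
  using scaleC_add_right[of a x "-x"] by (simp add: eq_neg_iff_add_eq_0 add.commute)

lemma scaleC_minus_left: "(- a) *\<^sub>C x = - (a *\<^sub>C (x::'a::complex_hilbert_space))"
  using scaleC_add_left[of a "-a" x] by (simp add: eq_neg_iff_add_eq_0 add.commute)

lemma scaleC_diff_right: "a *\<^sub>C (x - y) = a *\<^sub>C x - a *\<^sub>C (y::'a::complex_hilbert_space)"
  using scaleC_add_right[of a x "-y"] by (simp add: scaleC_minus_right)

lemma of_real_cmod_sq: "(complex_of_real (cmod z))\<^sup>2 = z * cnj z"
  by (metis complex_norm_square of_real_power)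

lemma of_real_cmod_mult: "complex_of_real (cmod z) * complex_of_real (cmod z) = z * cnj z"
  using of_real_cmod_sq[of z] by (simp add: power2_eq_square)

lemma norm_scaleC: "norm (a *\<^sub>C (x::'a::complex_hilbert_space)) = cmod a * norm x"
proof -
  have "complex_of_real ((norm (a *\<^sub>C x))\<^sup>2) = complex_of_real ((cmod a * norm x)\<^sup>2)"
    unfolding cinner_self[symmetric] cinner_scaleC_left cinner_scaleC_right
    by (simp add: cinner_self of_real_cmod_sq power_mult_distrib)
  then have "(norm (a *\<^sub>C x))\<^sup>2 = (cmod a * norm x)\<^sup>2"
    using of_real_eq_iff by blast
  then show ?thesis by simp
qed

text \<open>Cauchy--Schwarz with its remainder: on the left is the component of \<open>y\<close> orthogonal to \<open>x\<close>,
  scaled by \<open>|x|\<^sup>2\<close> to avoid a division.\<close>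

lemma norm_sq_cinner_residual:
  fixes x y :: "'a::complex_hilbert_space"
  shows "(norm ((norm x)\<^sup>2 *\<^sub>R y - cinner y x *\<^sub>C x))\<^sup>2
    = (norm x)\<^sup>2 * ((norm x)\<^sup>2 * (norm y)\<^sup>2 - (cmod (cinner y x))\<^sup>2)"
proof -
  have "complex_of_real ((norm ((norm x)\<^sup>2 *\<^sub>R y - cinner y x *\<^sub>C x))\<^sup>2)
    = complex_of_real ((norm x)\<^sup>2 * ((norm x)\<^sup>2 * (norm y)\<^sup>2 - (cmod (cinner y x))\<^sup>2))"
    unfolding cinner_self[symmetric] cinner_expand
    using cinner_commute[of x y]
    by (simp add: cinner_self of_real_cmod_mult algebra_simps power2_eq_square)
  then show ?thesis using of_real_eq_iff by blast
qed

lemma cmod_cinner_le: "cmod (cinner x y) \<le> norm x * norm (y::'a::complex_hilbert_space)"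
proof (cases "y = 0")
  case False
  have "0 \<le> (norm y)\<^sup>2 * ((norm y)\<^sup>2 * (norm x)\<^sup>2 - (cmod (cinner x y))\<^sup>2)"
    using norm_sq_cinner_residual[of y x] by (metis zero_le_power2)
  then have "(cmod (cinner x y))\<^sup>2 \<le> (norm x * norm y)\<^sup>2"
    using False by (simp add: zero_le_mult_iff power_mult_distrib mult.commute)
  then show ?thesis by (simp add: power2_le_iff_abs_le)
qed simp

lemma collinear_if_cmod_cinner_eq:
  fixes x y :: "'a::complex_hilbert_space"
  assumes "cmod (cinner y x) = norm x * norm y"
  shows "(norm x)\<^sup>2 *\<^sub>R y = cinner y x *\<^sub>C x"
  using norm_sq_cinner_residual[of x y] assms by (simp add: power_mult_distrib)

section \<open>Effects as quadratic forms\<close>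

lemma complex_linear_opD: "complex_linear_op A \<Longrightarrow> blinfun_apply A (a *\<^sub>C x) = a *\<^sub>C A x"
  by (simp add: complex_linear_op_def)

text \<open>Polarisation: the form is real at \<open>x + y\<close> and at \<open>x + \<i>y\<close>, which controls the
  imaginary and the real part of the off-diagonal entry.\<close>

lemma self_adjoint_if_real_form:
  fixes A :: "'a::complex_hilbert_space \<Rightarrow>\<^sub>L 'a"
  assumes "complex_linear_op A" and real: "\<And>x. Im (cinner (A x) x) = 0"
  shows "cinner (A x) y = cinner x (A y)"
proof -
  have "Im (cinner (A x) y) = - Im (cinner (A y) x)"
    using real[of "x + y"] real[of x] real[of y]
    by (simp add: blinfun.add_right cinner_expand)
  moreover have "Re (cinner (A x) y) = Re (cinner (A y) x)"
    using real[of "x + \<i> *\<^sub>C y"] real[of x] real[of y]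
    by (simp add: blinfun.add_right cinner_expand complex_linear_opD[OF assms(1)])
  ultimately have "cinner (A x) y = cnj (cinner (A y) x)"
    by (simp add: complex_eq_iff)
  then show ?thesis using cinner_commute by metis
qed

lemma in_nonneg_Reals_iff: "(z::complex) \<in> \<real>\<^sub>\<ge>\<^sub>0 \<longleftrightarrow> 0 \<le> Re z \<and> Im z = 0"
  by (auto simp: complex_nonneg_Reals_iff)

lemma effect_form_real: "A \<in> effects \<Longrightarrow> cinner (blinfun_apply A x) x = of_real (inner (A x) x)"
  by (auto simp: effects_def op_le_def positive_op_def in_nonneg_Reals_iff complex_eq_iff
      inner_eq_Re_cinner)

lemma effect_linear: "A \<in> effects \<Longrightarrow> blinfun_apply A (a *\<^sub>C x) = a *\<^sub>C A x"
  by (simp add: effects_def complex_linear_opD)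

lemma effect_self_adjoint: "A \<in> effects \<Longrightarrow> cinner (blinfun_apply A x) y = cinner x (A y)"
  by (rule self_adjoint_if_real_form) (simp add: effects_def, metis Im_complex_of_real effect_form_real)

lemma effect_nonneg: "A \<in> effects \<Longrightarrow> 0 \<le> inner (blinfun_apply A x) x"
  by (auto simp: effects_def op_le_def positive_op_def in_nonneg_Reals_iff inner_eq_Re_cinner)

lemma effect_le_norm_sq: "A \<in> effects \<Longrightarrow> inner (blinfun_apply A x) x \<le> (norm x)\<^sup>2"
  by (auto simp: effects_def op_le_def positive_op_def in_nonneg_Reals_iff
      inner_eq_Re_cinner blinfun.diff_left cinner_diff_left power2_norm_eq_inner)

lemma effectI:
  assumes "complex_linear_op A" "\<And>x. Im (cinner (blinfun_apply A x) x) = 0"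
    "\<And>x. 0 \<le> inner (blinfun_apply A x) x" "\<And>x. inner (blinfun_apply A x) x \<le> (norm x)\<^sup>2"
  shows "A \<in> effects"
  using assms by (auto simp: effects_def op_le_def positive_op_def in_nonneg_Reals_iff
      inner_eq_Re_cinner blinfun.diff_left cinner_diff_left cinner_self)

lemma op_le_effects_iff:
  assumes "A \<in> effects" "B \<in> effects"
  shows "A \<preceq> B \<longleftrightarrow> (\<forall>x. inner (blinfun_apply A x) x \<le> inner (blinfun_apply B x) x)"
  using effect_form_real[OF assms(1)] effect_form_real[OF assms(2)]
  by (auto simp: op_le_def positive_op_def in_nonneg_Reals_iff blinfun.diff_left cinner_diff_left)

lemma zero_effect: "0 \<in> effects"
  by (rule effectI) (auto simp: complex_linear_op_def)

lemma complement_effect: "A \<in> effects \<Longrightarrow> id_blinfun - A \<in> effects"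
  using effect_form_real[of A] effect_nonneg[of A] effect_le_norm_sq[of A] effect_linear[of A]
  by (intro effectI) (auto simp: complex_linear_op_def blinfun.diff_left cinner_expand
      inner_diff_left scaleC_diff_right cinner_self power2_norm_eq_inner)

text \<open>Cauchy--Schwarz for the form of a positive operator: the form is nonnegative at all vectors
  \<open>s x - t \<langle>A x, y\<rangle> y\<close>. The optimal choice is \<open>s = \<langle>A y, y\<rangle>\<close> and \<open>t = 1\<close>; if \<open>\<langle>A y, y\<rangle> = 0\<close>, then
  \<open>s = 1\<close> and a large \<open>t\<close> force \<open>\<langle>A x, y\<rangle> = 0\<close>.\<close>

lemma effect_Cauchy_Schwarz:
  assumes A: "A \<in> effects"
  shows "(cmod (cinner (blinfun_apply A x) y))\<^sup>2 \<le> inner (A x) x * inner (A y) y"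
proof -
  let ?a = "inner (A x) x" and ?b = "inner (A y) y" and ?c = "cinner (A x) y"
  have yx: "cinner (A y) x = cnj ?c"
    using effect_self_adjoint[OF A] cinner_commute by metis
  have form: "inner (A (s *\<^sub>R x - (of_real t * ?c) *\<^sub>C y)) (s *\<^sub>R x - (of_real t * ?c) *\<^sub>C y)
      = s\<^sup>2 * ?a - 2 * s * t * (cmod ?c)\<^sup>2 + t\<^sup>2 * (cmod ?c)\<^sup>2 * ?b" for s t :: real
  proof -
    have "complex_of_real (inner (A (s *\<^sub>R x - (of_real t * ?c) *\<^sub>C y)) (s *\<^sub>R x - (of_real t * ?c) *\<^sub>C y))
      = of_real (s\<^sup>2 * ?a - 2 * s * t * (cmod ?c)\<^sup>2 + t\<^sup>2 * (cmod ?c)\<^sup>2 * ?b)"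
      unfolding effect_form_real[OF A, symmetric]
      by (simp add: blinfun.diff_right blinfun.scaleR_right effect_linear[OF A] cinner_expand yx
          effect_form_real[OF A] of_real_cmod_sq)
        (simp add: algebra_simps power2_eq_square)
    then show ?thesis using of_real_eq_iff by blast
  qed
  consider "?c = 0" | "?c \<noteq> 0" "?b = 0" | "?c \<noteq> 0" "?b > 0"
    using effect_nonneg[OF A, of y] by linarith
  then show ?thesis
  proof cases
    case 1
    then show ?thesis using effect_nonneg[OF A] by simp
  next
    case 2
    have "0 \<le> ?a - 2 * t * (cmod ?c)\<^sup>2" for t
      using form[of 1 t] effect_nonneg[OF A, of "1 *\<^sub>R x - (of_real t * ?c) *\<^sub>C y"] 2 by simp
    from this[of "(?a + 1) / (2 * (cmod ?c)\<^sup>2)"] 2 show ?thesis by simp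
  next
    case 3
    have "0 \<le> ?b\<^sup>2 * ?a - 2 * ?b * (cmod ?c)\<^sup>2 + (cmod ?c)\<^sup>2 * ?b"
      using form[of ?b 1] effect_nonneg[OF A, of "?b *\<^sub>R x - (of_real 1 * ?c) *\<^sub>C y"] by simp
    then have "0 \<le> ?b * (?a * ?b - (cmod ?c)\<^sup>2)"
      by (simp add: algebra_simps power2_eq_square)
    then show ?thesis using 3 by (simp add: zero_le_mult_iff)
  qed
qed

text \<open>This is \<open>A\<^sup>2 \<preceq> A\<close>: apply Cauchy--Schwarz to \<open>x\<close> and \<open>A x\<close>.\<close>

lemma effect_norm_sq_le:
  assumes A: "A \<in> effects"
  shows "(norm (blinfun_apply A x))\<^sup>2 \<le> inner (A x) x"
proof (cases "A x = 0")
  case False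
  have "((norm (A x))\<^sup>2)\<^sup>2 \<le> inner (A x) x * inner (A (A x)) (A x)"
    using effect_Cauchy_Schwarz[OF A, of x "A x"] by (simp add: cinner_self norm_power)
  also have "\<dots> \<le> inner (A x) x * (norm (A x))\<^sup>2"
    by (intro mult_left_mono effect_le_norm_sq effect_nonneg A)
  finally show ?thesis using False by (simp add: power2_eq_square)
qed simp

lemma effect_apply_eq_0: "A \<in> effects \<Longrightarrow> inner (blinfun_apply A x) x \<le> 0 \<Longrightarrow> A x = 0"
  using effect_norm_sq_le[of A x] by (metis norm_eq_zero order_trans power2_less_eq_zero_iff)

lemma effect_eqI:
  assumes A: "A \<in> effects" and B: "B \<in> effects"
    and eq: "\<And>x. inner (blinfun_apply A x) x = inner (blinfun_apply B x) x"
  shows "A = B"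
proof (rule blinfun_eqI)
  fix x
  have sym: "inner (blinfun_apply C u) v = inner (C v) u" if "C \<in> effects" for C u v
    using effect_self_adjoint[OF that] by (metis inner_eq_Re_cinner inner_commute)
  have "inner (A x) y = inner (B x) y" for y
    using eq[of "x + y"] eq[of x] eq[of y] sym[OF A, of x y] sym[OF B, of x y]
    by (simp add: blinfun.add_right inner_add_left inner_add_right)
  then show "A x = B x" by (metis vector_eq_rdot)
qed

lemma op_le_antisym:
  assumes "A \<in> effects" "B \<in> effects" "A \<preceq> B" "B \<preceq> A"
  shows "A = B"
  using assms by (intro effect_eqI) (auto simp: op_le_effects_iff intro: order_antisym)

section \<open>Rank-one effects\<close>

text \<open>For a unit vector this is the projection onto the line of \<open>x\<close>.\<close>

definition rank_one :: "'a::complex_hilbert_space \<Rightarrow> 'a \<Rightarrow>\<^sub>L 'a" where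
  "rank_one x = Blinfun (\<lambda>y. cinner y x *\<^sub>C x)"

lemma rank_one_apply: "blinfun_apply (rank_one x) y = cinner y x *\<^sub>C x"
proof -
  have "bounded_linear (\<lambda>y. cinner y x *\<^sub>C x)"
  proof (rule bounded_linear_intro[where K = "norm x * norm x"])
    show "norm (cinner y x *\<^sub>C x) \<le> norm y * (norm x * norm x)" for y
      using mult_right_mono[OF cmod_cinner_le[of y x] norm_ge_zero[of x]]
      by (simp add: norm_scaleC mult.assoc)
  qed (simp_all add: cinner_expand scaleC_add_left scaleR_scaleC scaleC_scaleC)
  then show ?thesis by (simp add: rank_one_def bounded_linear_Blinfun_apply)
qed

lemma rank_one_cinner: "cinner (blinfun_apply (rank_one x) y) y = of_real ((cmod (cinner y x))\<^sup>2)"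
  unfolding rank_one_apply cinner_scaleC_left complex_norm_square by (metis cinner_commute)

lemma rank_one_form: "inner (blinfun_apply (rank_one x) y) y = (cmod (cinner y x))\<^sup>2"
  by (simp add: inner_eq_Re_cinner rank_one_cinner)

lemma rank_one_scaleC: "cmod a = 1 \<Longrightarrow> rank_one (a *\<^sub>C x) = rank_one x"
  by (rule blinfun_eqI)
    (simp add: rank_one_apply cinner_scaleC_right scaleC_scaleC mult.commute mult.assoc
      complex_norm_square[symmetric] flip: mult.assoc)

lemma rank_one_linear: "complex_linear_op (t *\<^sub>R rank_one x)"
  by (simp add: complex_linear_op_def blinfun.scaleR_left rank_one_apply cinner_scaleC_left
      scaleR_scaleC scaleC_scaleC mult.left_commute)

lemma rank_one_effectI:
  assumes "0 \<le> t" "\<And>y. t * (cmod (cinner y x))\<^sup>2 \<le> (norm y)\<^sup>2"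
  shows "t *\<^sub>R rank_one x \<in> effects"
proof (rule effectI)
  show "Im (cinner ((t *\<^sub>R rank_one x) y) y) = 0" for y
    by (simp add: blinfun.scaleR_left cinner_scaleR_left rank_one_cinner)
qed (use assms in \<open>simp_all add: rank_one_linear blinfun.scaleR_left rank_one_form\<close>)

lemma rank_one_effect:
  assumes "norm x = 1" "0 \<le> t" "t \<le> 1"
  shows "t *\<^sub>R rank_one x \<in> effects"
proof (rule rank_one_effectI)
  fix y
  have "(cmod (cinner y x))\<^sup>2 \<le> (norm y)\<^sup>2"
    using cmod_cinner_le[of y x] assms by (simp add: power_mono)
  then show "t * (cmod (cinner y x))\<^sup>2 \<le> (norm y)\<^sup>2"
    using mult_right_mono[OF assms(3), of "(cmod (cinner y x))\<^sup>2"] by (simp add: order_trans)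
qed fact

lemma rank_one_unit_effect: "norm x = 1 \<Longrightarrow> rank_one x \<in> effects"
  using rank_one_effect[of x 1] by simp

lemma rank_one_scaled_inject:
  assumes "norm x = 1" "s *\<^sub>R rank_one x = t *\<^sub>R rank_one x"
  shows "s = t"
  using arg_cong[OF assms(2), of "\<lambda>A. inner (blinfun_apply A x) x"] assms(1)
  by (simp add: blinfun.scaleR_left rank_one_form cinner_self)

lemma rank_one_scaled_le_iff:
  assumes "norm x = 1" "0 \<le> s" "s \<le> 1" "0 \<le> t" "t \<le> 1"
  shows "s *\<^sub>R rank_one x \<preceq> t *\<^sub>R rank_one x \<longleftrightarrow> s \<le> t"
proof -
  have "s \<le> t" if "\<forall>y. s * (cmod (cinner y x))\<^sup>2 \<le> t * (cmod (cinner y x))\<^sup>2"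
    using that[rule_format, of x] assms(1) by (simp add: cinner_self)
  then show ?thesis
    using assms by (auto simp: op_le_effects_iff rank_one_effect blinfun.scaleR_left rank_one_form
        intro: mult_right_mono)
qed

text \<open>An effect below a rank-one projection annihilates the orthogonal complement of its range,
  where the form of the projection vanishes; by self-adjointness it then maps into the range.\<close>

lemma effect_below_rank_one:
  assumes x: "norm x = 1" and A: "A \<in> effects" and le: "A \<preceq> rank_one x"
  obtains s where "0 \<le> s" "s \<le> 1" "A = s *\<^sub>R rank_one x"
proof -
  let ?r = "\<lambda>z. z - cinner z x *\<^sub>C x"
  have xx: "cinner x x = 1" using x by (simp add: cinner_self)
  have "A (?r z) = 0" for z
  proof (rule effect_apply_eq_0[OF A])
    have "inner (A (?r z)) (?r z) \<le> inner (rank_one x (?r z)) (?r z)"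
      using le op_le_effects_iff A rank_one_unit_effect[OF x] by blast
    then show "inner (A (?r z)) (?r z) \<le> 0"
      by (simp add: rank_one_form cinner_expand xx)
  qed
  note kernel = this
  have range: "A x = cinner (A x) x *\<^sub>C x"
  proof -
    have "cinner (?r (A x)) (?r (A x)) = cinner (A x) (?r (A x))"
      using cinner_commute[of x "A x"] by (simp add: cinner_expand xx)
    also have "\<dots> = 0" using kernel effect_self_adjoint[OF A] by (metis cinner_zero_right)
    finally show ?thesis by (simp add: cinner_self)
  qed
  have "A = inner (A x) x *\<^sub>R rank_one x"
  proof (rule blinfun_eqI)
    fix z
    have "A z = cinner z x *\<^sub>C A x"
      using kernel[of z] by (simp add: blinfun.diff_right effect_linear[OF A])
    then show "A z = (inner (A x) x *\<^sub>R rank_one x) z"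
      by (subst (asm) range) (simp add: effect_form_real[OF A] blinfun.scaleR_left rank_one_apply
          scaleR_scaleC scaleC_scaleC mult.commute)
  qed
  then show thesis
    using that effect_nonneg[OF A, of x] effect_le_norm_sq[OF A, of x] x by simp
qed

text \<open>Both directions complete a square. With \<open>w = p x + q y\<close> and
  \<open>N = (1 + u) |p|\<^sup>2 + (1 + v) |q|\<^sup>2\<close>, the condition \<open>|\<langle>x, y\<rangle>|\<^sup>2 \<le> u v\<close> amounts to \<open>|w|\<^sup>2 \<le> N\<close>
  for all scalars \<open>p\<close> and \<open>q\<close>. The two rank-one forms add up to \<open>N\<close> at a vector \<open>z\<close> when
  \<open>p = \<langle>z, x\<rangle> / (1 + u)\<close> and \<open>q = \<langle>z, y\<rangle> / (1 + v)\<close>, and then \<open>0 \<le> |z - w|\<^sup>2 = |z|\<^sup>2 - 2 N + |w|\<^sup>2\<close>.\<close>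

lemma rank_one_le_complement_iff:
  fixes x y :: "'a::complex_hilbert_space"
  assumes x: "norm x = 1" and y: "norm y = 1" and u: "0 \<le> u" and v: "0 \<le> v"
  shows "(1 / (1 + u)) *\<^sub>R rank_one x \<preceq> id_blinfun - (1 / (1 + v)) *\<^sub>R rank_one y
    \<longleftrightarrow> (cmod (cinner x y))\<^sup>2 \<le> u * v" (is "?le \<longleftrightarrow> ?c \<le> _")
proof -
  have "?le \<longleftrightarrow> (\<forall>z. (cmod (cinner z x))\<^sup>2 / (1 + u) + (cmod (cinner z y))\<^sup>2 / (1 + v) \<le> (norm z)\<^sup>2)"
    using x y u v
    by (subst op_le_effects_iff)
       (auto intro!: complement_effect rank_one_effect
        simp: blinfun.diff_left blinfun.scaleR_left inner_diff_left rank_one_form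
          power2_norm_eq_inner[symmetric] algebra_simps)
  also have "\<dots> \<longleftrightarrow> ?c \<le> u * v"
  proof (intro iffI allI)
    assume forms: "\<forall>z. (cmod (cinner z x))\<^sup>2 / (1 + u) + (cmod (cinner z y))\<^sup>2 / (1 + v) \<le> (norm z)\<^sup>2"
    \<comment> \<open>The inequality \<open>|p x + q y|\<^sup>2 \<le> N\<close> for \<open>p = a\<close> and \<open>q = b \<langle>x, y\<rangle>\<close>, a phase for which the
      cross term \<open>2 Re (p cnj q \<langle>x, y\<rangle>)\<close> is real.\<close>
    have "2 * a * b * ?c \<le> u * a\<^sup>2 + v * b\<^sup>2 * ?c" for a b :: real
    proof -
      define q where "q = b *\<^sub>R cinner x y"
      define z where "z = a *\<^sub>R x + q *\<^sub>C y"
      have young: "2 * Re (cnj p * w) \<le> (1 + t) * (cmod p)\<^sup>2 + (cmod w)\<^sup>2 / (1 + t)"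
        if "0 \<le> t" for p w :: complex and t :: real
      proof -
        have "((1 + t) * cmod p)\<^sup>2 + (cmod w)\<^sup>2 - 2 * (1 + t) * Re (cnj p * w)
          = ((1 + t) * Re p - Re w)\<^sup>2 + ((1 + t) * Im p - Im w)\<^sup>2"
          by (simp add: cmod_power2 power_mult_distrib) (simp add: power2_eq_square algebra_simps)
        then have "0 \<le> (((1 + t) * cmod p)\<^sup>2 + (cmod w)\<^sup>2 - 2 * (1 + t) * Re (cnj p * w)) / (1 + t)"
          using that by simp
        also have "\<dots> = (1 + t) * (cmod p)\<^sup>2 + (cmod w)\<^sup>2 / (1 + t) - 2 * Re (cnj p * w)"
          using that by (simp add: field_simps power2_eq_square)
        finally show ?thesis by simp
      qed
      have "(norm z)\<^sup>2 = Re (cinner z z)" by (simp add: cinner_self)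
      also have "\<dots> = Re (cnj (of_real a) * cinner z x) + Re (cnj q * cinner z y)"
        by (subst (2) z_def) (simp add: cinner_expand)
      finally have "2 * (norm z)\<^sup>2 \<le> (1 + u) * a\<^sup>2 + (1 + v) * (cmod q)\<^sup>2
          + ((cmod (cinner z x))\<^sup>2 / (1 + u) + (cmod (cinner z y))\<^sup>2 / (1 + v))"
        using young[OF u, of "of_real a" "cinner z x"] young[OF v, of q "cinner z y"] by simp
      then have "(norm z)\<^sup>2 \<le> (1 + u) * a\<^sup>2 + (1 + v) * (cmod q)\<^sup>2"
        using forms[rule_format, of z] by linarith
      moreover have "(norm z)\<^sup>2 = a\<^sup>2 + (cmod q)\<^sup>2 + 2 * a * b * ?c"
      proof -
        have "cinner x x = 1" "cinner y y = 1" using x y by (simp_all add: cinner_self)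
        then have "cinner z z = of_real (a\<^sup>2 + (cmod q)\<^sup>2 + 2 * a * b * ?c)"
          unfolding z_def q_def using cinner_commute[of y x]
          by (simp add: cinner_expand of_real_cmod_sq norm_mult power_mult_distrib)
             (simp add: scaleR_conv_of_real algebra_simps power2_eq_square of_real_cmod_mult)
        then have "complex_of_real ((norm z)\<^sup>2) = of_real (a\<^sup>2 + (cmod q)\<^sup>2 + 2 * a * b * ?c)"
          by (simp only: cinner_self)
        then show ?thesis using of_real_eq_iff by blast
      qed
      moreover have "(cmod q)\<^sup>2 = b\<^sup>2 * ?c" by (simp add: q_def power_mult_distrib)
      ultimately show ?thesis by (simp add: algebra_simps)
    qed
    note quadratic = this
    show "?c \<le> u * v"
    proof (cases "?c = 0 \<or> v = 0")
      case True
      moreover have "?c = 0" if "v = 0"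
        using quadratic[of 1 "(u + 1) / (2 * ?c)"] that by (cases "?c = 0") auto
      ultimately show ?thesis using u v by auto
    next
      case False
      have "v * ?c \<le> v * (u * v)"
        using quadratic[of v 1] by (simp add: power2_eq_square algebra_simps)
      then show ?thesis using False v by simp
    qed
  next
    fix z
    assume c: "?c \<le> u * v"
    define p q where "p = cinner z x /\<^sub>R (1 + u)" and "q = cinner z y /\<^sub>R (1 + v)"
    define w where "w = p *\<^sub>C x + q *\<^sub>C y"
    define N where "N = (cmod (cinner z x))\<^sup>2 / (1 + u) + (cmod (cinner z y))\<^sup>2 / (1 + v)"
    have zx: "cinner z x = of_real (1 + u) * p" and zy: "cinner z y = of_real (1 + v) * q"
      using u v by (simp_all add: p_def q_def scaleR_conv_of_real field_simps flip: of_real_add)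
    have N: "N = (1 + u) * (cmod p)\<^sup>2 + (1 + v) * (cmod q)\<^sup>2"
    proof -
      have "(\<bar>1 + t\<bar> * r)\<^sup>2 / (1 + t) = (1 + t) * r\<^sup>2" if "0 \<le> t" for t r :: real
        using that by (simp add: power2_eq_square)
      then show ?thesis unfolding N_def zx zy norm_mult norm_of_real using u v by simp
    qed
    have zw: "inner z w = N"
      by (simp add: inner_eq_Re_cinner w_def cinner_expand zx zy N cmod_power2)
         (simp add: algebra_simps power2_eq_square)
    have "(norm w)\<^sup>2 = (cmod p)\<^sup>2 + (cmod q)\<^sup>2 + 2 * Re (p * cnj q * cinner x y)"
    proof -
      have "(norm w)\<^sup>2 = Re (cinner w w)" by (simp add: cinner_self)
      also have "cinner w w = of_real ((cmod p)\<^sup>2) + of_real ((cmod q)\<^sup>2)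
          + (p * cnj q * cinner x y + cnj (p * cnj q * cinner x y))"
        using cinner_commute[of y x] cinner_self[of x] cinner_self[of y]
        by (simp add: w_def cinner_expand x y of_real_cmod_sq algebra_simps)
      finally show ?thesis by (simp add: algebra_simps)
    qed
    also have "2 * Re (p * cnj q * cinner x y) \<le> 2 * (cmod p * cmod q * cmod (cinner x y))"
      using complex_Re_le_cmod[of "p * cnj q * cinner x y"] by (simp add: norm_mult)
    also have "\<dots> \<le> 2 * (cmod p * cmod q * (sqrt u * sqrt v))"
      using real_le_rsqrt[OF c] by (intro mult_left_mono) (simp_all add: real_sqrt_mult)
    also have "\<dots> \<le> u * (cmod p)\<^sup>2 + v * (cmod q)\<^sup>2"
      using zero_le_power2[of "sqrt u * cmod p - sqrt v * cmod q"] u v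
      by (simp add: power2_diff power_mult_distrib algebra_simps)
    finally have "(norm w)\<^sup>2 \<le> N" by (simp add: N algebra_simps)
    moreover have "0 \<le> (norm z)\<^sup>2 - 2 * inner z w + (norm w)\<^sup>2"
      using zero_le_power2[of "norm (z - w)"] by (simp add: power2_norm_eq_inner inner_diff_left
          inner_diff_right inner_commute)
    ultimately show "(cmod (cinner z x))\<^sup>2 / (1 + u) + (cmod (cinner z y))\<^sup>2 / (1 + v) \<le> (norm z)\<^sup>2"
      using zw by (simp add: N_def[symmetric])
  qed
  finally show ?thesis .
qed

section \<open>Projections in terms of order and complement\<close>

definition sharp :: "('a::complex_hilbert_space \<Rightarrow>\<^sub>L 'a) \<Rightarrow> bool" where
  "sharp A \<longleftrightarrow> A \<in> effects \<and> (\<forall>C\<in>effects. C \<preceq> A \<and> C \<preceq> id_blinfun - A \<longrightarrow> C = 0)"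

text \<open>If \<open>A\<^sup>2 \<noteq> A\<close>, then \<open>A - A\<^sup>2\<close> is a nonzero effect below both \<open>A\<close> and its complement. Conversely, an
  effect below a projection vanishes on its kernel, and one below the complement vanishes on its
  range.\<close>

lemma sharp_iff_idempotent:
  assumes A: "A \<in> effects"
  shows "sharp A \<longleftrightarrow> (\<forall>x. blinfun_apply A (A x) = A x)"
proof
  assume sharp: "sharp A"
  let ?C = "A - (A o\<^sub>L A)"
  have form: "cinner (?C x) x = of_real (inner (A x) x - (norm (A x))\<^sup>2)" for x
  proof -
    have "cinner (A (A x)) x = of_real ((norm (A x))\<^sup>2)"
      using effect_self_adjoint[OF A, of "A x" x] by (simp only: cinner_self)
    then show ?thesis by (simp add: blinfun.diff_left cinner_diff_left effect_form_real[OF A])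
  qed
  have rform: "inner (?C x) x = inner (A x) x - (norm (A x))\<^sup>2" for x
    by (simp only: inner_eq_Re_cinner[of "?C x"] form Re_complex_of_real)
  have C: "?C \<in> effects"
  proof (rule effectI)
    show "complex_linear_op ?C"
      by (simp add: complex_linear_op_def blinfun.diff_left effect_linear[OF A] scaleC_diff_right)
    show "Im (cinner (?C x) x) = 0" for x by (simp only: form Im_complex_of_real)
    show "0 \<le> inner (?C x) x" for x using rform effect_norm_sq_le[OF A] by simp
    show "inner (?C x) x \<le> (norm x)\<^sup>2" for x
      using rform[of x] effect_le_norm_sq[OF A, of x] zero_le_power2[of "norm (A x)"] by linarith
  qed
  have "?C \<preceq> A" using rform by (simp add: op_le_effects_iff[OF C A])
  moreover have "?C \<preceq> id_blinfun - A"
  proof -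
    have "inner (A x) x - (norm (A x))\<^sup>2 \<le> (norm x)\<^sup>2 - inner (A x) x" for x
      using zero_le_power2[of "norm (x - A x)"]
      by (simp add: power2_norm_eq_inner inner_diff_left inner_diff_right inner_commute)
    then show ?thesis
      using rform by (simp add: op_le_effects_iff[OF C complement_effect[OF A]] blinfun.diff_left
          inner_diff_left power2_norm_eq_inner)
  qed
  ultimately have "?C = 0" using sharp C unfolding sharp_def by blast
  then have "blinfun_apply ?C x = 0" for x by simp
  then show "\<forall>x. A (A x) = A x" by (simp add: blinfun.diff_left)
next
  assume idem: "\<forall>x. blinfun_apply A (A x) = A x"
  have "C = 0" if C: "C \<in> effects" "C \<preceq> A" "C \<preceq> id_blinfun - A" for C
  proof (rule blinfun_eqI)
    fix x
    have "inner (C (A x)) (A x) \<le> inner ((id_blinfun - A) (A x)) (A x)"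
      using C op_le_effects_iff complement_effect A by blast
    then have "C (A x) = 0"
      by (intro effect_apply_eq_0 C) (simp add: blinfun.diff_left idem)
    moreover have "inner (C (x - A x)) (x - A x) \<le> inner (A (x - A x)) (x - A x)"
      using C op_le_effects_iff A by blast
    then have "C (x - A x) = 0"
      by (intro effect_apply_eq_0 C) (simp add: blinfun.diff_right idem)
    ultimately show "C x = (0 :: 'a \<Rightarrow>\<^sub>L 'a) x" by (simp add: blinfun.diff_right)
  qed
  then show "sharp A" using A by (auto simp: sharp_def)
qed

lemma sharp_rank_one: "norm x = 1 \<Longrightarrow> sharp (rank_one x)"
  by (simp add: sharp_iff_idempotent rank_one_unit_effect rank_one_apply cinner_scaleC_left cinner_self)

lemma rank_one_nonzero: "norm x = 1 \<Longrightarrow> rank_one x \<noteq> 0"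
  using rank_one_scaled_inject[of x 1 0] by auto

text \<open>Minimality among the nonzero sharp effects, stated without reference to vectors so that every
  automorphism visibly preserves it.\<close>

definition atomic :: "('a::complex_hilbert_space \<Rightarrow>\<^sub>L 'a) \<Rightarrow> bool" where
  "atomic P \<longleftrightarrow> sharp P \<and> P \<noteq> 0 \<and> (\<forall>Q. sharp Q \<and> Q \<preceq> P \<longrightarrow> Q = 0 \<or> Q = P)"

lemma atomic_rank_one:
  assumes x: "norm x = 1"
  shows "atomic (rank_one x)"
  unfolding atomic_def
proof (intro conjI allI impI)
  fix Q assume Q: "sharp Q \<and> Q \<preceq> rank_one x"
  then have "Q \<in> effects" by (simp add: sharp_def)
  then obtain s where s: "0 \<le> s" "s \<le> 1" "Q = s *\<^sub>R rank_one x"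
    using effect_below_rank_one x Q by blast
  have xx: "cinner x x = 1" using x by (simp add: cinner_self)
  have "Q (Q x) = Q x" using Q \<open>Q \<in> effects\<close> sharp_iff_idempotent by blast
  then have "s *\<^sub>R s *\<^sub>R x = s *\<^sub>R x"
    by (simp add: s blinfun.scaleR_left rank_one_apply cinner_expand xx scaleC_one scaleC_scaleC
        scaleR_scaleC del: scaleR_scaleR)
  then have "s = 0 \<or> s = 1" using x by auto
  then show "Q = 0 \<or> Q = rank_one x" using s by auto
qed (simp_all add: sharp_rank_one rank_one_nonzero x)

text \<open>Any unit vector in the range of a projection spans a rank-one projection below it.\<close>

lemma atomicE:
  assumes P: "atomic P"
  obtains x where "norm x = 1" "P = rank_one x"
proof -
  have sharp: "sharp P" and nz: "P \<noteq> 0" and eff: "P \<in> effects"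
    using P by (auto simp: atomic_def sharp_def)
  have idem: "P (P x) = P x" for x using sharp eff sharp_iff_idempotent by blast
  obtain y where y: "P y \<noteq> 0" using nz by (metis blinfun_eqI zero_blinfun.rep_eq)
  define x where "x = P y /\<^sub>R norm (P y)"
  have x: "norm x = 1" "P x = x" using y idem by (simp_all add: x_def blinfun.scaleR_right)
  have "rank_one x \<preceq> P"
  proof -
    have "(cmod (cinner z x))\<^sup>2 \<le> inner (P z) z" for z
    proof -
      have "cinner z x = cinner (P z) x" using effect_self_adjoint[OF eff, of z x] x by simp
      then have "cmod (cinner z x) \<le> norm (P z)" using cmod_cinner_le[of "P z" x] x by simp
      then have "(cmod (cinner z x))\<^sup>2 \<le> (norm (P z))\<^sup>2" by (rule power_mono) simp
      then show ?thesis using effect_norm_sq_le[OF eff, of z] by (rule order_trans)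
    qed
    then show ?thesis using rank_one_unit_effect[OF x(1)] eff by (simp add: op_le_effects_iff rank_one_form)
  qed
  then have "P = rank_one x"
    using P sharp_rank_one[OF x(1)] rank_one_nonzero[OF x(1)] unfolding atomic_def by metis
  then show thesis using that x by blast
qed

section \<open>Action of an automorphism on rank-one effects\<close>

lemma automorphism_effect: "ortho_order_automorphism \<phi> \<Longrightarrow> A \<in> effects \<Longrightarrow> \<phi> A \<in> effects"
  unfolding ortho_order_automorphism_def by (blast dest: bij_betwE)

lemma automorphism_le_iff:
  "ortho_order_automorphism \<phi> \<Longrightarrow> A \<in> effects \<Longrightarrow> B \<in> effects \<Longrightarrow> \<phi> A \<preceq> \<phi> B \<longleftrightarrow> A \<preceq> B"
  unfolding ortho_order_automorphism_def by blast

lemma automorphism_complement: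
  "ortho_order_automorphism \<phi> \<Longrightarrow> A \<in> effects \<Longrightarrow> \<phi> (id_blinfun - A) = id_blinfun - \<phi> A"
  unfolding ortho_order_automorphism_def by blast

lemma automorphism_eq_iff:
  assumes "ortho_order_automorphism \<phi>" "A \<in> effects" "B \<in> effects"
  shows "\<phi> A = \<phi> B \<longleftrightarrow> A = B"
  using assms unfolding ortho_order_automorphism_def bij_betw_def inj_on_def by blast

lemma automorphism_inverse:
  assumes \<phi>: "ortho_order_automorphism \<phi>"
  obtains \<psi> where "ortho_order_automorphism \<psi>"
    "\<And>A. A \<in> effects \<Longrightarrow> \<phi> (\<psi> A) = A" "\<And>A. A \<in> effects \<Longrightarrow> \<psi> (\<phi> A) = A"
proof
  let ?\<psi> = "inv_into effects \<phi>"
  have bij: "bij_betw \<phi> effects effects" using \<phi> by (simp add: ortho_order_automorphism_def)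
  then have bij': "bij_betw ?\<psi> effects effects" by (rule bij_betw_inv_into)
  show right: "\<phi> (?\<psi> A) = A" if "A \<in> effects" for A
    using bij that by (rule bij_betw_inv_into_right)
  show left: "?\<psi> (\<phi> A) = A" if "A \<in> effects" for A
    using bij that by (rule bij_betw_inv_into_left)
  have mem: "?\<psi> A \<in> effects" if "A \<in> effects" for A using bij' that by (rule bij_betw_apply)
  show "ortho_order_automorphism ?\<psi>"
    unfolding ortho_order_automorphism_def
  proof (intro conjI ballI bij')
    show "A \<preceq> B \<longleftrightarrow> ?\<psi> A \<preceq> ?\<psi> B" if "A \<in> effects" "B \<in> effects" for A B
      using automorphism_le_iff[OF \<phi> mem[OF that(1)] mem[OF that(2)]] right that by simp
    show "?\<psi> (id_blinfun - A) = id_blinfun - ?\<psi> A" if "A \<in> effects" for A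
      using automorphism_complement[OF \<phi> mem[OF that]] right[OF that] left complement_effect mem that
      by metis
  qed
qed

lemma automorphism_zero:
  assumes \<phi>: "ortho_order_automorphism \<phi>"
  shows "\<phi> 0 = 0"
proof -
  obtain \<psi> where \<psi>: "ortho_order_automorphism \<psi>" "\<And>A. A \<in> effects \<Longrightarrow> \<phi> (\<psi> A) = A"
    by (rule automorphism_inverse[OF \<phi>]) blast
  have least: "0 \<preceq> A" if "A \<in> effects" for A :: "'a \<Rightarrow>\<^sub>L 'a" using that by (simp add: effects_def)
  have "\<phi> 0 \<preceq> \<phi> (\<psi> 0)"
    using automorphism_le_iff[OF \<phi> zero_effect] automorphism_effect[OF \<psi>(1) zero_effect] least by blast
  then show ?thesis
    using op_le_antisym zero_effect automorphism_effect[OF \<phi> zero_effect] least \<psi>(2) by metis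
qed

lemma automorphism_sharp:
  assumes \<phi>: "ortho_order_automorphism \<phi>" and A: "sharp A"
  shows "sharp (\<phi> A)"
proof -
  obtain \<psi> where \<psi>: "ortho_order_automorphism \<psi>"
    "\<And>A. A \<in> effects \<Longrightarrow> \<phi> (\<psi> A) = A" "\<And>A. A \<in> effects \<Longrightarrow> \<psi> (\<phi> A) = A"
    by (rule automorphism_inverse[OF \<phi>]) blast
  have eff: "A \<in> effects" using A by (simp add: sharp_def)
  have "C = 0" if C: "C \<in> effects" "C \<preceq> \<phi> A" "C \<preceq> id_blinfun - \<phi> A" for C
  proof -
    have "\<psi> C \<in> effects" using \<psi>(1) C(1) automorphism_effect by blast
    moreover have "\<psi> C \<preceq> A"
      using C automorphism_le_iff[OF \<phi> \<open>\<psi> C \<in> effects\<close> eff] \<psi>(2) by simp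
    moreover have "\<psi> C \<preceq> id_blinfun - A"
      using C automorphism_le_iff[OF \<phi> \<open>\<psi> C \<in> effects\<close> complement_effect[OF eff]] \<psi>(2)
        automorphism_complement[OF \<phi> eff] by simp
    ultimately have "\<psi> C = 0" using A by (simp add: sharp_def)
    then show "C = 0" using \<psi>(2)[OF C(1)] automorphism_zero[OF \<phi>] by simp
  qed
  then show ?thesis using automorphism_effect[OF \<phi> eff] by (auto simp: sharp_def)
qed

lemma automorphism_atomic:
  assumes \<phi>: "ortho_order_automorphism \<phi>" and P: "atomic P"
  shows "atomic (\<phi> P)"
proof -
  obtain \<psi> where \<psi>: "ortho_order_automorphism \<psi>"
    "\<And>A. A \<in> effects \<Longrightarrow> \<phi> (\<psi> A) = A" "\<And>A. A \<in> effects \<Longrightarrow> \<psi> (\<phi> A) = A"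
    by (rule automorphism_inverse[OF \<phi>]) blast
  have sharp: "sharp P" and eff: "P \<in> effects" using P by (auto simp: atomic_def sharp_def)
  have "\<phi> P \<noteq> 0"
    using automorphism_eq_iff[OF \<phi> eff zero_effect] automorphism_zero[OF \<phi>] P
    by (simp add: atomic_def)
  moreover have "Q = 0 \<or> Q = \<phi> P" if Q: "sharp Q" "Q \<preceq> \<phi> P" for Q
  proof -
    have "Q \<in> effects" using Q by (simp add: sharp_def)
    have "sharp (\<psi> Q)" using automorphism_sharp[OF \<psi>(1)] Q by blast
    moreover have "\<psi> Q \<preceq> P"
      using Q automorphism_le_iff[OF \<phi> automorphism_effect[OF \<psi>(1) \<open>Q \<in> effects\<close>] eff] \<psi>(2)[OF \<open>Q \<in> effects\<close>]
      by simp
    ultimately have "\<psi> Q = 0 \<or> \<psi> Q = P" using P by (simp add: atomic_def)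
    then show ?thesis using \<psi>(2)[OF \<open>Q \<in> effects\<close>] automorphism_zero[OF \<phi>] by metis
  qed
  ultimately show ?thesis using automorphism_sharp[OF \<phi> sharp] by (simp add: atomic_def)
qed

lemma automorphism_rank_one:
  assumes "ortho_order_automorphism \<phi>" "norm x = 1"
  obtains y where "norm y = 1" "\<phi> (rank_one x) = rank_one y"
  using atomicE[OF automorphism_atomic[OF assms(1) atomic_rank_one[OF assms(2)]]] by blast

lemma automorphism_scaled_rank_one:
  assumes \<phi>: "ortho_order_automorphism \<phi>" and x: "norm x = 1"
    and y: "norm y = 1" "\<phi> (rank_one x) = rank_one y" and s: "0 < s" "s \<le> 1"
  obtains t where "0 < t" "t \<le> 1" "\<phi> (s *\<^sub>R rank_one x) = t *\<^sub>R rank_one y"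
proof -
  have eff: "s *\<^sub>R rank_one x \<in> effects" using s x by (simp add: rank_one_effect)
  have "s *\<^sub>R rank_one x \<preceq> rank_one x"
    using rank_one_scaled_le_iff[of x s 1] s x by simp
  then have "\<phi> (s *\<^sub>R rank_one x) \<preceq> rank_one y"
    using automorphism_le_iff[OF \<phi> eff rank_one_unit_effect[OF x]] y by simp
  then obtain t where t: "0 \<le> t" "t \<le> 1" "\<phi> (s *\<^sub>R rank_one x) = t *\<^sub>R rank_one y"
    using effect_below_rank_one[OF y(1) automorphism_effect[OF \<phi> eff]] by blast
  have "\<phi> (s *\<^sub>R rank_one x) \<noteq> 0"
    using automorphism_eq_iff[OF \<phi> eff zero_effect] automorphism_zero[OF \<phi>]
      rank_one_nonzero[OF x] s by simp
  then have "t \<noteq> 0" using t(3) by auto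
  then show thesis using that[of t] t by simp
qed

section \<open>Monotone multiplicative functions\<close>

lemma le_one_if_powers_le:
  fixes q :: real
  assumes "\<And>n. q ^ n \<le> K"
  shows "q \<le> 1"
proof (rule ccontr)
  assume "\<not> q \<le> 1"
  then obtain n where "K < q ^ n" using real_arch_pow[of q K] by auto
  then show False using assms[of n] by simp
qed

text \<open>On powers of two the function is the identity. Squeezing \<open>u\<^sup>n\<close> between consecutive powers of
  two bounds the \<open>n\<close>-th powers of \<open>g u / u\<close> and of its reciprocal by \<open>2\<close>, for every \<open>n\<close>.\<close>

lemma monotone_multiplicative_eq_id:
  fixes g :: "real \<Rightarrow> real"
  assumes mono: "\<And>a b. 0 < a \<Longrightarrow> a \<le> b \<Longrightarrow> g a \<le> g b"
    and mult: "\<And>a b. 0 < a \<Longrightarrow> 0 < b \<Longrightarrow> g (a * b) = g a * g b"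
    and half: "g (1/2) = 1/2" and pos: "\<And>a. 0 < a \<Longrightarrow> 0 < g a" and u: "0 < u"
  shows "g u = u"
proof -
  have one: "g 1 = 1" using mult[of 1 1] pos[of 1] by simp
  then have two: "g 2 = 2" using mult[of 2 "1/2"] half by simp
  have pow: "g (a ^ n) = g a ^ n" if "0 < a" for a n
    by (induction n) (simp_all add: one mult that)
  have powi: "g (2 powi k) = 2 powi k" for k
  proof (cases "0 \<le> k")
    case True
    then show ?thesis using pow[of 2 "nat k"] two by (simp add: power_int_def)
  next
    case False
    then show ?thesis using pow[of "1/2" "nat (- k)"] half
      by (simp add: power_int_def inverse_eq_divide)
  qed
  have bounds: "g u ^ n \<le> 2 * u ^ n \<and> u ^ n \<le> 2 * g u ^ n" for n
  proof -
    let ?k = "\<lfloor>log 2 (u ^ n)\<rfloor>"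
    have eq: "2 powr log 2 (u ^ n) = u ^ n" using u by simp
    have lower: "2 powi ?k \<le> u ^ n"
      using powr_mono[of "of_int ?k" "log 2 (u ^ n)" 2] eq by (simp add: powr_real_of_int')
    have upper: "u ^ n \<le> 2 powi (?k + 1)"
      using powr_mono[of "log 2 (u ^ n)" "of_int (?k + 1)" 2] eq real_of_int_floor_add_one_ge[of "log 2 (u ^ n)"]
      by (simp add: powr_real_of_int' flip: of_int_add)
    have step: "(2::real) powi (?k + 1) = 2 * 2 powi ?k" by (simp add: power_int_add)
    have "2 powi ?k \<le> g u ^ n" using mono[OF _ lower] u by (simp add: powi pow)
    moreover have "g u ^ n \<le> 2 powi (?k + 1)"
      using mono[OF _ upper] u powi[of "?k + 1"] pow[of u n] by simp
    ultimately show ?thesis using lower upper step by linarith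
  qed
  have "g u / u \<le> 1"
    by (rule le_one_if_powers_le[where K = 2]) (use bounds u in \<open>simp add: power_divide field_simps\<close>)
  moreover have "u / g u \<le> 1"
    by (rule le_one_if_powers_le[where K = 2])
       (use bounds pos[OF u] in \<open>simp add: power_divide field_simps\<close>)
  ultimately show ?thesis using u pos[OF u] by (simp add: field_simps)
qed

section \<open>Wigner's theorem\<close>

text \<open>The inner products determine the length of \<open>S (x + y) - S x - S y\<close>, which is that of
  \<open>(x + y) - x - y = 0\<close>.\<close>

lemma real_inner_preserving_additive:
  fixes S :: "'a::real_inner \<Rightarrow> 'b::real_inner"
  assumes inner: "\<And>x y. x \<in> V \<Longrightarrow> y \<in> V \<Longrightarrow> inner (S x) (S y) = inner x y"
    and "x \<in> V" "y \<in> V" "x + y \<in> V"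
  shows "S (x + y) = S x + S y"
proof -
  have "inner (S (x + y) - S x - S y) (S (x + y) - S x - S y)
      = inner (x + y - x - y) (x + y - x - y)"
    using assms by (simp only: inner_diff_left inner_diff_right)
  then have "S (x + y) - S x - S y = 0" by simp
  then show ?thesis by (simp add: algebra_simps)
qed

lemma real_inner_preserving_scaleR:
  fixes S :: "'a::real_inner \<Rightarrow> 'b::real_inner"
  assumes inner: "\<And>x y. x \<in> V \<Longrightarrow> y \<in> V \<Longrightarrow> inner (S x) (S y) = inner x y"
    and "x \<in> V" "r *\<^sub>R x \<in> V"
  shows "S (r *\<^sub>R x) = r *\<^sub>R S x"
proof -
  have "inner (S (r *\<^sub>R x) - r *\<^sub>R S x) (S (r *\<^sub>R x) - r *\<^sub>R S x)
      = inner (r *\<^sub>R x - r *\<^sub>R x) (r *\<^sub>R x - r *\<^sub>R x)"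
    using assms by (simp add: inner_diff_left inner_diff_right)
  then show ?thesis by simp
qed

text \<open>The hypotheses determine each \<open>T x\<close> only up to phase. A reference vector removes this freedom:
  with \<open>e' = T e\<close> and \<open>x\<close> orthogonal to \<open>e\<close>, the vector \<open>T (e + x)\<close> has a unique multiple of the form
  \<open>e' + S x\<close> with \<open>S x\<close> orthogonal to \<open>e'\<close>. As \<open>S x\<close> and \<open>T x\<close> agree up to phase, comparing \<open>|\<langle>S x, S y\<rangle>|\<close> with
  \<open>|1 + \<langle>S x, S y\<rangle>|\<close> shows that \<open>S\<close> preserves real parts of inner products, so that it is
  real-linear. Since \<open>S (\<i> x)\<close> is collinear with \<open>S x\<close> and orthogonal to it in the real inner product,
  \<open>S (\<i> x) = \<plusminus>\<i> S x\<close>, where the sign cannot depend on \<open>x\<close> because a vector space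
  is not the union of two proper subspaces.\<close>

theorem Wigner:
  fixes T :: "'a::complex_hilbert_space \<Rightarrow> 'a"
  assumes overlap: "\<And>x y. cmod (cinner (T x) (T y)) = cmod (cinner x y)"
    and surj: "\<And>y. \<exists>x a. cmod a = 1 \<and> y = a *\<^sub>C T x"
    and e: "norm (e::'a) = 1"
  obtains U where "unitary_op U \<or> antiunitary_op U"
    "\<And>x. \<exists>a. cmod a = 1 \<and> blinfun_apply U x = a *\<^sub>C T x"
proof -
  have norm_T: "norm (T x) = norm x" for x
    using overlap[of x x] by (simp add: cinner_self norm_power)
  have norm_eqI: "norm u = norm v" if "cinner u u = cinner v v" for u v :: 'a
    using that by (simp add: cinner_self power2_eq_iff_nonneg flip: of_real_power)
  define V where "V = {x. cinner x e = 0}"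
  have V_add: "x + y \<in> V" if "x \<in> V" "y \<in> V" for x y
    using that by (simp add: V_def cinner_expand)
  have V_scale: "a *\<^sub>C x \<in> V" "r *\<^sub>R x \<in> V" if "x \<in> V" for x a r
    using that by (simp_all add: V_def cinner_expand)
  have ex: "cinner e x = 0" if "x \<in> V" for x
    using that cinner_commute[of e x] by (simp add: V_def)
  have ee: "cinner e e = 1" using e by (simp add: cinner_self)
  define e' where "e' = T e"
  have e'e': "cinner e' e' = 1" using norm_T e by (simp add: e'_def cinner_self)
  have "\<exists>a. cmod a = 1 \<and> cinner (a *\<^sub>C T (e + x)) e' = 1" if "x \<in> V" for x
  proof -
    have "cmod (cinner (T (e + x)) e') = 1"
      using overlap[of "e + x" e] that by (simp add: e'_def V_def cinner_add_left ee)
    then show ?thesis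
      by (intro exI[of _ "inverse (cinner (T (e + x)) e')"])
         (auto simp: norm_inverse cinner_scaleC_left intro!: left_inverse)
  qed
  then obtain ph where ph: "\<And>x. x \<in> V \<Longrightarrow> cmod (ph x) = 1"
      "\<And>x. x \<in> V \<Longrightarrow> cinner (ph x *\<^sub>C T (e + x)) e' = 1"
    by metis
  define S where "S = (\<lambda>x. ph x *\<^sub>C T (e + x) - e')"
  have Se': "cinner (S x) e' = 0" if "x \<in> V" for x
    using ph(2)[OF that] by (simp add: S_def cinner_diff_left e'e')
  then have e'S: "cinner e' (S x) = 0" if "x \<in> V" for x
    using that cinner_commute[of e' "S x"] by simp
  have T_eS: "ph x *\<^sub>C T (e + x) = e' + S x" for x by (simp add: S_def)
  have one_plus: "cmod (1 + cinner (S x) (S y)) = cmod (1 + cinner x y)" if "x \<in> V" "y \<in> V" for x y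
  proof -
    have "1 + cinner (S x) (S y) = cinner (e' + S x) (e' + S y)"
      using that by (simp add: cinner_expand e'e' Se' e'S)
    also have "cmod \<dots> = cmod (cinner (T (e + x)) (T (e + y)))"
      using ph(1) that by (simp add: T_eS[symmetric] cinner_expand norm_mult)
    also have "\<dots> = cmod (1 + cinner x y)"
      using that ex by (simp add: overlap cinner_expand ee) (simp add: V_def)
    finally show ?thesis .
  qed
  have norm_S: "norm (S x) = norm x" if "x \<in> V" for x
  proof -
    have "cmod (1 + cinner v v) = 1 + (norm v)\<^sup>2" for v :: 'a
    proof -
      have "1 + cinner v v = of_real (1 + (norm v)\<^sup>2)" by (simp add: cinner_self)
      then show ?thesis by (simp only: norm_of_real) simp
    qed
    then show ?thesis using one_plus[OF that that] by simp
  qed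
  have collinear: "\<exists>a. cmod a = 1 \<and> v = a *\<^sub>C u"
    if "cmod (cinner v u) = norm u * norm v" "norm u = norm v" for u v :: 'a
  proof (cases "u = 0")
    case True
    then show ?thesis using that by (intro exI[of _ 1]) simp
  next
    case False
    have "((norm u)\<^sup>2) *\<^sub>R v = cinner v u *\<^sub>C u" by (rule collinear_if_cmod_cinner_eq) fact
    moreover have "v = inverse ((norm u)\<^sup>2) *\<^sub>R (norm u)\<^sup>2 *\<^sub>R v" using False by simp
    ultimately have "v = inverse ((norm u)\<^sup>2) *\<^sub>R cinner v u *\<^sub>C u" by metis
    then have "v = (cinner v u / (norm u)\<^sup>2) *\<^sub>C u" by (simp add: scaleR_scaleC scaleC_scaleC field_simps)
    moreover have "cmod (cinner v u / (norm u)\<^sup>2) = 1"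
      using that False by (auto simp: norm_divide norm_mult power2_eq_square)
    ultimately show ?thesis by blast
  qed
  have S_T: "\<exists>a. cmod a = 1 \<and> S x = a *\<^sub>C T x" if "x \<in> V" for x
  proof (rule collinear)
    have "cmod (cinner (S x) (T x)) = cmod (cinner (T (e + x)) (T x))"
    proof -
      have "cinner e' (T x) = 0"
        using overlap[of e x] ex[OF that] by (simp add: e'_def)
      then show ?thesis using ph(1)[OF that] by (simp add: S_def cinner_expand norm_mult)
    qed
    also have "\<dots> = (norm x)\<^sup>2"
      using ex[OF that] by (simp add: overlap cinner_expand cinner_self norm_power)
    finally show "cmod (cinner (S x) (T x)) = norm (T x) * norm (S x)"
      using norm_S[OF that] norm_T by (simp add: power2_eq_square)
    show "norm (T x) = norm (S x)" using norm_S[OF that] norm_T by simp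
  qed
  have overlap_S: "cmod (cinner (S x) (S y)) = cmod (cinner x y)" if xy: "x \<in> V" "y \<in> V" for x y
  proof -
    obtain a b where "cmod a = 1" "S x = a *\<^sub>C T x" "cmod b = 1" "S y = b *\<^sub>C T y"
      using S_T xy by blast
    then show ?thesis by (simp add: cinner_expand norm_mult overlap)
  qed
  have inner_S: "inner (S x) (S y) = inner x y" if "x \<in> V" "y \<in> V" for x y
  proof -
    have expand: "(cmod (1 + z))\<^sup>2 = 1 + 2 * Re z + (cmod z)\<^sup>2" for z
      by (simp add: cmod_power2) (simp add: power2_eq_square algebra_simps)
    show ?thesis
      using expand[of "cinner x y"] expand[of "cinner (S x) (S y)"] one_plus[OF that] overlap_S[OF that]
      by (simp add: inner_eq_Re_cinner)
  qed
  have S_add: "S (x + y) = S x + S y" if "x \<in> V" "y \<in> V" for x y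
    using real_inner_preserving_additive[of V S x y] inner_S that V_add by blast
  have S_scaleR: "S (r *\<^sub>R x) = r *\<^sub>R S x" if "x \<in> V" for x r
    using real_inner_preserving_scaleR[of V S x r] inner_S that V_scale(2) by blast
  have S_i: "S (\<i> *\<^sub>C x) = \<i> *\<^sub>C S x \<or> S (\<i> *\<^sub>C x) = - (\<i> *\<^sub>C S x)" if x: "x \<in> V" for x
  proof (cases "x = 0")
    case True
    then show ?thesis using norm_S[OF x] by simp
  next
    case False
    have ix: "\<i> *\<^sub>C x \<in> V" using V_scale(1) x by blast
    have "cmod (cinner (S (\<i> *\<^sub>C x)) (S x)) = norm (S x) * norm (S (\<i> *\<^sub>C x))"
      using overlap_S[OF ix x] norm_S[OF x] norm_S[OF ix]
      by (simp add: cinner_expand norm_mult cinner_self norm_scaleC power2_eq_square norm_power)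
    then obtain a where a: "cmod a = 1" "S (\<i> *\<^sub>C x) = a *\<^sub>C S x"
      using collinear norm_S[OF x] norm_S[OF ix] by (metis norm_scaleC norm_ii mult_1)
    have "inner (S (\<i> *\<^sub>C x)) (S x) = 0"
      using inner_S[OF ix x] by (simp add: inner_eq_Re_cinner cinner_expand cinner_self)
    then have "Re a = 0"
      using False norm_S[OF x] by (simp add: a inner_eq_Re_cinner cinner_expand cinner_self flip: of_real_power)
    then have "Im a = 1 \<or> Im a = -1"
      using a(1) cmod_power2[of a] by (simp add: power2_eq_1_iff)
    then have "a = \<i> \<or> a = - \<i>" using \<open>Re a = 0\<close> by (simp add: complex_eq_iff)
    then show ?thesis using a(2) by (auto simp: scaleC_minus_left)
  qed
  \<comment> \<open>If vectors \<open>x\<close> and \<open>y\<close> had different signs, neither sign would work for \<open>x + y\<close>.\<close>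
  have "(\<forall>x\<in>V. S (\<i> *\<^sub>C x) = \<i> *\<^sub>C S x) \<or> (\<forall>x\<in>V. S (\<i> *\<^sub>C x) = - (\<i> *\<^sub>C S x))"
  proof (rule ccontr)
    assume "\<not> ?thesis"
    then obtain x y where xy: "x \<in> V" "S (\<i> *\<^sub>C x) \<noteq> \<i> *\<^sub>C S x" "y \<in> V" "S (\<i> *\<^sub>C y) \<noteq> - (\<i> *\<^sub>C S y)"
      by blast
    then have "S (\<i> *\<^sub>C x) = - (\<i> *\<^sub>C S x)" "S (\<i> *\<^sub>C y) = \<i> *\<^sub>C S y" using S_i by blast+
    moreover have "S (\<i> *\<^sub>C (x + y)) = S (\<i> *\<^sub>C x) + S (\<i> *\<^sub>C y)"
      using xy by (simp add: scaleC_add_right S_add V_scale)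
    ultimately have sum: "S (\<i> *\<^sub>C (x + y)) = \<i> *\<^sub>C S y - \<i> *\<^sub>C S x" by simp
    have double: "w + w \<noteq> 0" if "w \<noteq> 0" for w :: 'a
      using that by (metis scaleR_2 scaleR_eq_0_iff zero_neq_numeral)
    have split: "\<i> *\<^sub>C S (x + y) = \<i> *\<^sub>C S x + \<i> *\<^sub>C S y"
      using xy by (simp add: S_add scaleC_add_right)
    from S_i[OF V_add[OF xy(1,3)]] show False
    proof
      assume "S (\<i> *\<^sub>C (x + y)) = \<i> *\<^sub>C S (x + y)"
      then have "(\<i> *\<^sub>C S x + \<i> *\<^sub>C S y) - (\<i> *\<^sub>C S y - \<i> *\<^sub>C S x) = 0"
        using sum split by simp
      then have "\<i> *\<^sub>C S x = 0" using double[of "\<i> *\<^sub>C S x"] by (auto simp: algebra_simps)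
      then show False using xy(2) \<open>S (\<i> *\<^sub>C x) = - (\<i> *\<^sub>C S x)\<close> by simp
    next
      assume "S (\<i> *\<^sub>C (x + y)) = - (\<i> *\<^sub>C S (x + y))"
      then have "\<i> *\<^sub>C S y = - (\<i> *\<^sub>C S y)"
        using sum split by simp
      then have "\<i> *\<^sub>C S y = 0" using double[of "\<i> *\<^sub>C S y"] by (metis add.right_inverse)
      then show False using xy(4) \<open>S (\<i> *\<^sub>C y) = \<i> *\<^sub>C S y\<close> by simp
    qed
  qed
  \<comment> \<open>\<open>\<sigma>\<close> is the identity or complex conjugation, to treat both signs at once.\<close>
  then obtain \<sigma> :: "complex \<Rightarrow> complex" where \<sigma>: "\<sigma> = id \<or> \<sigma> = cnj"
    and S_i': "\<And>x. x \<in> V \<Longrightarrow> S (\<i> *\<^sub>C x) = \<sigma> \<i> *\<^sub>C S x"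
  proof
    assume *: "\<forall>x\<in>V. S (\<i> *\<^sub>C x) = \<i> *\<^sub>C S x"
    show thesis by (rule that[of id]) (use * in simp_all)
  next
    assume *: "\<forall>x\<in>V. S (\<i> *\<^sub>C x) = - (\<i> *\<^sub>C S x)"
    show thesis by (rule that[of cnj]) (use * in \<open>simp_all add: scaleC_minus_left\<close>)
  qed
  have \<sigma>_simps: "\<sigma> (a + b) = \<sigma> a + \<sigma> b" "\<sigma> (a * b) = \<sigma> a * \<sigma> b" "\<sigma> (of_real r) = of_real r"
    "cmod (\<sigma> a) = cmod a" "\<sigma> (\<sigma> a) = a" "\<sigma> (cnj a) = cnj (\<sigma> a)" "\<sigma> 0 = 0" "\<sigma> 1 = 1"
    "\<sigma> (inverse a) = inverse (\<sigma> a)"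
    for a b r using \<sigma> by auto
  have S_scaleC: "S (a *\<^sub>C x) = \<sigma> a *\<^sub>C S x" if x: "x \<in> V" for a x
  proof -
    have a: "a = of_real (Re a) + of_real (Im a) * \<i>" by (simp add: complex_eq_iff)
    have "a *\<^sub>C x = Re a *\<^sub>R x + Im a *\<^sub>R (\<i> *\<^sub>C x)"
      by (subst a) (simp only: scaleC_add_left scaleR_scaleC scaleC_scaleC)
    then have "S (a *\<^sub>C x) = Re a *\<^sub>R S x + Im a *\<^sub>R (\<sigma> \<i> *\<^sub>C S x)"
      using x by (simp add: S_add S_scaleR S_i' V_scale)
    also have "\<dots> = (of_real (Re a) + of_real (Im a) * \<sigma> \<i>) *\<^sub>C S x"
      by (simp only: scaleC_add_left scaleR_scaleC scaleC_scaleC)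
    also have "of_real (Re a) + of_real (Im a) * \<sigma> \<i> = \<sigma> a"
      by (subst (3) a) (simp only: \<sigma>_simps)
    finally show ?thesis .
  qed
  have cinner_S: "cinner (S x) (S y) = \<sigma> (cinner x y)" if "x \<in> V" "y \<in> V" for x y
  proof -
    have "inner (S x) (\<sigma> \<i> *\<^sub>C S y) = inner x (\<i> *\<^sub>C y)"
      using inner_S[OF that(1) V_scale(1)[OF that(2)], of \<i>] S_i'[OF that(2)] by simp
    then have "Re (cnj (\<sigma> \<i>) * cinner (S x) (S y)) = Re (cnj \<i> * cinner x y)"
      by (simp add: inner_eq_Re_cinner cinner_scaleC_right)
    moreover have "Re (cinner (S x) (S y)) = Re (cinner x y)"
      using inner_S[OF that] by (simp add: inner_eq_Re_cinner)
    ultimately show ?thesis using \<sigma> by (auto simp: complex_eq_iff)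
  qed
  define F where "F = (\<lambda>x. \<sigma> (cinner x e) *\<^sub>C e' + S (x - cinner x e *\<^sub>C e))"
  have residual: "x - cinner x e *\<^sub>C e \<in> V" for x by (simp add: V_def cinner_expand ee)
  have F_add: "F (x + y) = F x + F y" for x y
  proof -
    have eq: "x + y - cinner (x + y) e *\<^sub>C e = (x - cinner x e *\<^sub>C e) + (y - cinner y e *\<^sub>C e)"
      by (simp add: cinner_expand scaleC_add_left)
    then show ?thesis
      unfolding F_def eq S_add[OF residual residual]
      by (simp add: cinner_add_left \<sigma>_simps scaleC_add_left)
  qed
  have F_scaleC: "F (a *\<^sub>C x) = \<sigma> a *\<^sub>C F x" for a x
  proof -
    have eq: "a *\<^sub>C x - cinner (a *\<^sub>C x) e *\<^sub>C e = a *\<^sub>C (x - cinner x e *\<^sub>C e)"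
      by (simp add: cinner_expand scaleC_diff_right scaleC_scaleC)
    then show ?thesis
      unfolding F_def eq S_scaleC[OF residual]
      by (simp add: cinner_scaleC_left \<sigma>_simps scaleC_add_right scaleC_scaleC)
  qed
  have cinner_F: "cinner (F x) (F y) = \<sigma> (cinner x y)" for x y
  proof -
    let ?x = "x - cinner x e *\<^sub>C e" and ?y = "y - cinner y e *\<^sub>C e"
    have "cinner (a *\<^sub>C e' + S u) (b *\<^sub>C e' + S v) = a * cnj b + \<sigma> (cinner u v)"
      if "u \<in> V" "v \<in> V" for a b u v
      using that by (simp add: cinner_add_left cinner_add_right cinner_scaleC_left
          cinner_scaleC_right e'e' Se' e'S cinner_S)
    then have "cinner (F x) (F y) = \<sigma> (cinner x e * cnj (cinner y e) + cinner ?x ?y)"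
      unfolding F_def by (simp only: residual \<sigma>_simps)
    also have "cinner x e * cnj (cinner y e) + cinner ?x ?y = cinner x y"
      using cinner_commute[of e y] by (simp add: cinner_expand ee algebra_simps)
    finally show ?thesis .
  qed
  have norm_F: "norm (F x) = norm x" for x
  proof -
    have "cinner (F x) (F x) = cinner x x"
      using cinner_F[of x x] by (simp only: cinner_self \<sigma>_simps)
    then show ?thesis by (rule norm_eqI)
  qed
  have F_T: "\<exists>a. cmod a = 1 \<and> F x = a *\<^sub>C T x" for x
  proof (cases "cinner x e = 0")
    case True
    then show ?thesis using S_T[of x] by (simp add: F_def V_def \<sigma>_simps)
  next
    case False
    let ?b = "cinner x e"
    define y where "y = inverse ?b *\<^sub>C (x - ?b *\<^sub>C e)"
    have y: "y \<in> V" using residual V_scale(1) y_def by blast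
    have x: "x = ?b *\<^sub>C (e + y)"
      using False by (simp add: y_def scaleC_add_right scaleC_scaleC scaleC_one)
    have "\<sigma> ?b * inverse (\<sigma> ?b) = 1" using False \<sigma> by auto
    then have "F x = \<sigma> ?b *\<^sub>C (e' + S y)"
      using S_scaleC[OF residual, of "inverse ?b" x]
      by (simp add: F_def y_def scaleC_add_right scaleC_scaleC scaleC_one \<sigma>_simps)
    then have Fx: "F x = (\<sigma> ?b * ph y) *\<^sub>C T (e + y)" by (simp add: T_eS[symmetric] scaleC_scaleC)
    have "cmod (cinner (F x) (T x)) = cmod ?b * cmod (cinner (e + y) x)"
      using ph(1)[OF y] by (simp add: Fx cinner_expand norm_mult overlap \<sigma>_simps)
    also have "\<dots> = cmod (cinner x x)"
      by (subst (3) x) (simp add: cinner_scaleC_left norm_mult)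
    finally have "cmod (cinner (F x) (T x)) = norm (T x) * norm (F x)"
      by (simp add: cinner_self norm_F norm_T norm_mult power2_eq_square)
    then show ?thesis by (rule collinear) (simp add: norm_F norm_T)
  qed
  have linear: "bounded_linear F"
  proof (rule bounded_linear_intro[where K = 1])
    show "F (r *\<^sub>R x) = r *\<^sub>R F x" for r x by (simp add: scaleR_scaleC F_scaleC \<sigma>_simps)
  qed (simp_all add: F_add norm_F)
  have surj_F: "surj F"
    unfolding surj_def
  proof
    fix y
    obtain x a where xa: "cmod a = 1" "y = a *\<^sub>C T x" using surj by blast
    obtain b where b: "cmod b = 1" "F x = b *\<^sub>C T x" using F_T by blast
    then have "b \<noteq> 0" by auto
    have "F (\<sigma> (a * inverse b) *\<^sub>C x) = y"
      using \<open>b \<noteq> 0\<close> by (simp add: F_scaleC \<sigma>_simps b xa scaleC_scaleC mult.assoc)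
    then show "\<exists>x. y = F x" by metis
  qed
  let ?U = "Blinfun F"
  have U: "blinfun_apply ?U = F" using linear by (rule bounded_linear_Blinfun_apply)
  from \<sigma> have "unitary_op ?U \<or> antiunitary_op ?U"
  proof
    assume "\<sigma> = id"
    then have "unitary_op ?U"
      using surj_F F_scaleC cinner_F by (simp add: unitary_op_def complex_linear_op_def U)
    then show ?thesis ..
  next
    assume "\<sigma> = cnj"
    then have "antiunitary_op ?U"
      using surj_F F_scaleC cinner_F by (simp add: antiunitary_op_def conjugate_linear_op_def U)
    then show ?thesis ..
  qed
  then show thesis using that[of ?U] F_T by (simp add: U)
qed

section \<open>Transition probabilities are preserved\<close>

definition overlap :: "'a::complex_hilbert_space \<Rightarrow> 'a \<Rightarrow> real" where
  "overlap x y = (cmod (cinner x y))\<^sup>2"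

lemma overlap_commute: "overlap x y = overlap y x"
  by (simp add: overlap_def cmod_cinner_commute)

lemma overlap_nonneg: "0 \<le> overlap x y"
  by (simp add: overlap_def)

lemma overlap_self: "norm x = 1 \<Longrightarrow> overlap x x = 1"
  by (simp add: overlap_def cinner_self)

lemma overlap_rank_one_cong: "rank_one y = rank_one z \<Longrightarrow> overlap x y = overlap x z"
  unfolding overlap_def rank_one_form[symmetric] by simp

lemma overlap_Bessel:
  assumes e: "norm e = 1" and f: "norm f = 1" and orth: "cinner e f = 0" and r: "norm r = 1"
  shows "overlap e r + overlap f r \<le> 1"
proof -
  let ?d = "r - cinner r e *\<^sub>C e - cinner r f *\<^sub>C f"
  have one: "cinner e e = 1" "cinner f f = 1" "cinner r r = 1" using e f r by (simp_all add: cinner_self)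
  have "cinner f e = 0" using orth cinner_commute[of f e] by simp
  then have "cinner ?d ?d = of_real (1 - (cmod (cinner r e))\<^sup>2 - (cmod (cinner r f))\<^sup>2)"
    using orth cinner_commute[of e r] cinner_commute[of f r]
    by (simp add: cinner_expand one of_real_cmod_sq)
  then have "complex_of_real ((norm ?d)\<^sup>2) = of_real (1 - (cmod (cinner r e))\<^sup>2 - (cmod (cinner r f))\<^sup>2)"
    by (simp only: cinner_self)
  then have "(norm ?d)\<^sup>2 = 1 - (cmod (cinner r e))\<^sup>2 - (cmod (cinner r f))\<^sup>2"
    using of_real_eq_iff by blast
  then show ?thesis
    using zero_le_power2[of "norm ?d"]
    by (simp add: overlap_def cmod_cinner_commute[of e r] cmod_cinner_commute[of f r])
qed

lemma orthonormal_combination: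
  assumes e: "norm e = 1" and f: "norm f = 1" and orth: "cinner e f = 0" and ab: "a\<^sup>2 + b\<^sup>2 = 1"
  shows "norm (a *\<^sub>R e + b *\<^sub>R f) = 1" "overlap e (a *\<^sub>R e + b *\<^sub>R f) = a\<^sup>2"
    "overlap f (a *\<^sub>R e + b *\<^sub>R f) = b\<^sup>2"
proof -
  have one: "cinner e e = 1" "cinner f f = 1" using e f by (simp_all add: cinner_self)
  have fe: "cinner f e = 0" using orth cinner_commute[of f e] by simp
  have "cinner (a *\<^sub>R e + b *\<^sub>R f) (a *\<^sub>R e + b *\<^sub>R f) = of_real (a\<^sup>2 + b\<^sup>2)"
    by (simp add: cinner_expand one orth fe power2_eq_square)
  then have "complex_of_real ((norm (a *\<^sub>R e + b *\<^sub>R f))\<^sup>2) = of_real 1"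
    by (simp only: cinner_self ab)
  then have "(norm (a *\<^sub>R e + b *\<^sub>R f))\<^sup>2 = 1" using of_real_eq_iff by blast
  then show "norm (a *\<^sub>R e + b *\<^sub>R f) = 1"
    by (metis norm_ge_zero one_power2 power2_eq_iff_nonneg zero_le_one)
  show "overlap e (a *\<^sub>R e + b *\<^sub>R f) = a\<^sup>2" "overlap f (a *\<^sub>R e + b *\<^sub>R f) = b\<^sup>2"
    by (simp_all add: overlap_def cinner_expand one orth fe)
qed

text \<open>The sum of \<open>x\<close> and of a multiple of \<open>y\<close> with matching phase bisects the two lines.\<close>

lemma common_overlap:
  assumes x: "norm x = 1" and y: "norm y = 1"
  obtains r where "norm r = 1" "overlap x r = overlap y r" "0 < overlap x r"
proof -
  let ?c = "cinner x y"
  define \<omega> where "\<omega> = (if ?c = 0 then 1 else sgn ?c)"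
  have \<omega>: "cmod \<omega> = 1" by (simp add: \<omega>_def norm_sgn)
  then have \<omega>1: "\<omega> * cnj \<omega> = 1" by (metis complex_norm_square of_real_1 one_power2)
  define m where "m = cmod ?c"
  have m: "0 \<le> m" by (simp add: m_def)
  have c: "?c = of_real m * \<omega>" by (simp add: m_def \<omega>_def sgn_div_norm scaleR_conv_of_real)
  define s where "s = x + \<omega> *\<^sub>C y"
  have one: "cinner x x = 1" "cinner y y = 1" using x y by (simp_all add: cinner_self)
  have "cinner x s = of_real (1 + m)"
    using \<omega>1 by (simp add: s_def cinner_expand one c mult.commute mult.left_commute)
  then have xs: "cmod (cinner x s) = 1 + m" using m by (simp only: norm_of_real; simp)
  have "cinner y x = of_real m * cnj \<omega>" by (subst cinner_commute) (simp add: c)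
  then have "cinner y s = of_real (1 + m) * cnj \<omega>"
    by (simp add: s_def cinner_expand one algebra_simps)
  then have ys: "cmod (cinner y s) = 1 + m"
    using \<omega> m by (simp only: norm_of_real norm_mult complex_mod_cnj; simp)
  have "s \<noteq> 0" using xs m by auto
  let ?r = "s /\<^sub>R norm s"
  show thesis
  proof (rule that)
    show "norm ?r = 1" using \<open>s \<noteq> 0\<close> by simp
    show "overlap x ?r = overlap y ?r" by (simp add: overlap_def cinner_scaleR_right norm_mult xs ys)
    show "0 < overlap x ?r"
      using m \<open>s \<noteq> 0\<close> by (simp add: overlap_def cinner_scaleR_right norm_mult xs power_mult_distrib)
  qed
qed

text \<open>
  The functional equation \<open>G x u * G y (c / u) = c'\<close> with \<open>c = overlap x y\<close> and
  \<open>c' = overlap (T x) (T y)\<close> gives \<open>G x u * G x (1 / u) = 1\<close> for \<open>y = x\<close>, and hence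
  \<open>G y (c u) = c' G x u\<close> and \<open>c' = G y c\<close>. If \<open>r\<close> has the same positive overlap with \<open>x\<close> and \<open>y\<close>, these
  express \<open>G x\<close> and \<open>G y\<close> by \<open>G r\<close> in the same way, so \<open>G\<close> does not depend on the line. It is then
  multiplicative, since every \<open>c\<close> in \<open>(0, 1]\<close> is an overlap. What remains is a power \<open>c' = c\<^sup>p\<close>, and
  Bessel's inequality excludes \<open>p < 1\<close> in the target and \<open>p > 1\<close> in the source.
\<close>

lemma weights_rigid:
  fixes G :: "'a::complex_hilbert_space \<Rightarrow> real \<Rightarrow> real" and T :: "'a \<Rightarrow> 'a" and e f :: 'a
  assumes unit: "\<And>x. norm x = 1 \<Longrightarrow> norm (T x) = 1"
    and nonneg: "\<And>x u. norm x = 1 \<Longrightarrow> 0 \<le> u \<Longrightarrow> 0 \<le> G x u"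
    and onto: "\<And>x w. norm x = 1 \<Longrightarrow> 0 \<le> w \<Longrightarrow> \<exists>u\<ge>0. G x u = w"
    and mono: "\<And>x u v. norm x = 1 \<Longrightarrow> 0 \<le> u \<Longrightarrow> 0 \<le> v \<Longrightarrow> G x u \<le> G x v \<longleftrightarrow> u \<le> v"
    and coexist: "\<And>x y u v. norm x = 1 \<Longrightarrow> norm y = 1 \<Longrightarrow> 0 \<le> u \<Longrightarrow> 0 \<le> v \<Longrightarrow>
      overlap (T x) (T y) \<le> G x u * G y v \<longleftrightarrow> overlap x y \<le> u * v"
    and onto_T: "\<And>y. norm y = 1 \<Longrightarrow> \<exists>x. norm x = 1 \<and> rank_one (T x) = rank_one y"
    and e: "norm e = 1" and f: "norm f = 1" and orth: "cinner e f = 0"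
  shows "\<And>x u. norm x = 1 \<Longrightarrow> 0 \<le> u \<Longrightarrow> G x u = u"
    and "\<And>x y. norm x = 1 \<Longrightarrow> norm y = 1 \<Longrightarrow> overlap (T x) (T y) = overlap x y"
proof -
  have zero: "G x 0 = 0" if x: "norm x = 1" for x
  proof -
    obtain u where "0 \<le> u" "G x u = 0" using onto[OF x, of 0] by auto
    then show ?thesis using mono[OF x, of 0 u] nonneg[OF x, of 0] by simp
  qed
  have pos: "0 < G x u" if x: "norm x = 1" and u: "0 < u" for x u
    using mono[OF x, of u 0] zero[OF x] u by auto
  \<comment> \<open>The least \<open>v\<close> that is admissible for \<open>u\<close> is \<open>overlap x y / u\<close>, and \<open>G\<close> maps it to the least
    admissible weight of the images.\<close>
  have key: "G x u * G y (overlap x y / u) = overlap (T x) (T y)"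
    if x: "norm x = 1" and y: "norm y = 1" and u: "0 < u" for x y u
  proof (rule antisym)
    have nn: "0 \<le> overlap x y / u" using u by (simp add: overlap_nonneg)
    show "overlap (T x) (T y) \<le> G x u * G y (overlap x y / u)"
      using coexist[OF x y _ nn, of u] u by simp
    obtain v where v: "0 \<le> v" "G y v = overlap (T x) (T y) / G x u"
      using onto[OF y, of "overlap (T x) (T y) / G x u"] pos[OF x u] overlap_nonneg[of "T x" "T y"] by auto
    have "overlap x y \<le> u * v"
      using coexist[OF x y _ v(1), of u] v(2) pos[OF x u] u by simp
    then have "overlap x y / u \<le> v" using u by (simp add: divide_le_eq mult.commute)
    then have "G y (overlap x y / u) \<le> overlap (T x) (T y) / G x u"
      using mono[OF y nn v(1)] v(2) by simp
    then show "G x u * G y (overlap x y / u) \<le> overlap (T x) (T y)"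
      using pos[OF x u] by (simp add: le_divide_eq mult.commute)
  qed
  have inv: "G x u * G x (1 / u) = 1" if "norm x = 1" "0 < u" for x u
    using key[OF that(1) that(1) that(2)] that(1) unit by (simp add: overlap_self)
  have one: "G x 1 = 1" if "norm x = 1" for x
    using inv[OF that, of 1] pos[OF that, of 1] by (simp add: power2_eq_1_iff flip: power2_eq_square)
  have scale: "G y (overlap x y * u) = overlap (T x) (T y) * G x u"
    if x: "norm x = 1" and y: "norm y = 1" and u: "0 \<le> u" for x y u
  proof (cases "u = 0")
    case True
    then show ?thesis using zero x y by simp
  next
    case False
    then have u: "0 < u" using u by simp
    have "G y (overlap x y * u) = (G x u * G x (1 / u)) * G y (overlap x y * u)"
      by (simp add: inv[OF x u])
    also have "\<dots> = (G x (1 / u) * G y (overlap x y / (1 / u))) * G x u" by simp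
    also have "\<dots> = overlap (T x) (T y) * G x u" using key[OF x y, of "1 / u"] u by simp
    finally show ?thesis .
  qed
  have G_overlap: "G y (overlap x y) = overlap (T x) (T y)" if "norm x = 1" "norm y = 1" for x y
    using scale[OF that, of 1] one[OF that(1)] by simp
  have G_eq: "G x u = G y u" if x: "norm x = 1" and y: "norm y = 1" and u: "0 \<le> u" for x y u
  proof -
    obtain r where r: "norm r = 1" "overlap x r = overlap y r" "0 < overlap x r"
      using common_overlap[OF x y] by blast
    have "G z u = G r (overlap x r) * G r (u / overlap x r)" if z: "norm z = 1" "overlap z r = overlap x r" for z
      using scale[OF r(1) z(1), of "u / overlap x r"] G_overlap[OF z(1) r(1)] u r z
      by (simp add: overlap_commute[of r z] overlap_commute[of "T r" "T z"])
    from this[OF x refl] this[OF y r(2)[symmetric]] show ?thesis by simp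
  qed
  let ?g = "G e"
  have mult_unit: "?g (c * u) = ?g c * ?g u" if c: "0 < c" "c \<le> 1" and u: "0 < u" for c u
  proof -
    define y where "y = sqrt c *\<^sub>R e + sqrt (1 - c) *\<^sub>R f"
    have "(sqrt c)\<^sup>2 + (sqrt (1 - c))\<^sup>2 = 1" using c by simp
    from orthonormal_combination[OF e f orth this] have y: "norm y = 1" "overlap e y = c"
      using c by (simp_all add: y_def)
    have "G y (c * u) = overlap (T e) (T y) * ?g u"
      using scale[OF e y(1), of u] u y(2) by simp
    moreover have "G y c = overlap (T e) (T y)" using G_overlap[OF e y(1)] y(2) by simp
    ultimately show ?thesis
      using G_eq[OF y(1) e, of "c * u"] G_eq[OF y(1) e, of c] c u by simp
  qed
  have mult: "?g (a * b) = ?g a * ?g b" if a: "0 < a" and b: "0 < b" for a b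
  proof (cases "a \<le> 1")
    case False
    have "?g b = ?g (1 / a) * ?g (a * b)"
      using mult_unit[of "1 / a" "a * b"] a b False by simp
    then have "?g a * ?g b = (?g a * ?g (1 / a)) * ?g (a * b)" by simp
    then show ?thesis using inv[OF e a] by simp
  qed (use mult_unit a b in simp)
  \<comment> \<open>A unit vector \<open>r\<close> that bisects \<open>e\<close> and \<open>f\<close> has equal overlaps \<open>g (1/2)\<close> after applying \<open>T\<close>.
    Conversely, the bisector of \<open>T e\<close> and \<open>T f\<close> comes from a vector \<open>q\<close> with equal overlaps with
    \<open>e\<close> and \<open>f\<close>. Bessel's inequality bounds equal overlaps by \<open>1/2\<close>.\<close>
  have half: "?g (1/2) = 1/2"
  proof (rule antisym)
    let ?h = "sqrt (1/2)"
    have hh: "?h\<^sup>2 + ?h\<^sup>2 = 1" by simp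
    have orth': "cinner (T e) (T f) = 0"
      using coexist[OF e f, of 0 0] zero e orth by (simp add: overlap_def)
    define r where "r = ?h *\<^sub>R e + ?h *\<^sub>R f"
    have r: "norm r = 1" "overlap e r = 1/2" "overlap f r = 1/2"
      using orthonormal_combination[OF e f orth hh] by (simp_all add: r_def)
    have "?g (1/2) = overlap (T e) (T r)" "?g (1/2) = overlap (T f) (T r)"
      using G_overlap[OF e r(1)] G_overlap[OF f r(1)] r G_eq[OF r(1) e, of "1/2"] by simp_all
    then show "?g (1/2) \<le> 1/2"
      using overlap_Bessel[OF unit[OF e] unit[OF f] orth' unit[OF r(1)]] by simp
    define r' where "r' = ?h *\<^sub>R T e + ?h *\<^sub>R T f"
    have r': "norm r' = 1" "overlap (T e) r' = 1/2" "overlap (T f) r' = 1/2"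
      using orthonormal_combination[OF unit[OF e] unit[OF f] orth' hh] by (simp_all add: r'_def)
    obtain q where q: "norm q = 1" "rank_one (T q) = rank_one r'" using onto_T[OF r'(1)] by blast
    have "?g (overlap e q) = 1/2" "?g (overlap f q) = 1/2"
      using G_overlap[OF e q(1)] G_overlap[OF f q(1)] r'
      by (simp_all add: overlap_rank_one_cong[OF q(2)] G_eq[OF e q(1)] overlap_nonneg)
    moreover from this have "overlap e q = overlap f q"
      using mono[OF e, of "overlap e q" "overlap f q"] mono[OF e, of "overlap f q" "overlap e q"]
        overlap_nonneg by (intro antisym) auto
    then have "overlap e q \<le> 1/2" using overlap_Bessel[OF e f orth q(1)] by simp
    ultimately show "1/2 \<le> ?g (1/2)"
      using mono[OF e, of "overlap e q" "1/2"] overlap_nonneg[of e q] by simp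
  qed
  have id: "?g u = u" if "0 < u" for u
    by (rule monotone_multiplicative_eq_id[OF _ mult half pos[OF e] that])
       (simp_all add: mono[OF e])
  show G_id: "G x u = u" if "norm x = 1" "0 \<le> u" for x u
    using G_eq[OF that(1) e that(2)] id[of u] zero[OF e] that(2) by (cases "u = 0") auto
  show "overlap (T x) (T y) = overlap x y" if "norm x = 1" "norm y = 1" for x y
    using G_overlap[OF that] G_id[OF that(2) overlap_nonneg, of x y] by simp
qed

text \<open>The weights are parametrised as \<open>1 / (1 + u)\<close> because the coexistence condition for two lines is
  then a lower bound for the product of the parameters.\<close>

definition weight_map ::
    "(('a::complex_hilbert_space \<Rightarrow>\<^sub>L 'a) \<Rightarrow> ('a \<Rightarrow>\<^sub>L 'a)) \<Rightarrow> 'a \<Rightarrow> 'a \<Rightarrow> (real \<Rightarrow> real) \<Rightarrow> bool" where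
  "weight_map \<phi> x y g \<longleftrightarrow> (\<forall>u\<ge>0. 0 \<le> g u) \<and>
    (\<forall>u\<ge>0. \<phi> ((1 / (1 + u)) *\<^sub>R rank_one x) = (1 / (1 + g u)) *\<^sub>R rank_one y) \<and>
    (\<forall>w\<ge>0. \<exists>u\<ge>0. g u = w) \<and> (\<forall>u\<ge>0. \<forall>v\<ge>0. g u \<le> g v \<longleftrightarrow> u \<le> v)"

lemma automorphism_weights:
  fixes x y :: "'a::complex_hilbert_space"
  assumes \<phi>: "ortho_order_automorphism \<phi>" and x: "norm x = 1"
    and y: "norm y = 1" and xy: "\<phi> (rank_one x) = rank_one y"
  shows "\<exists>g. weight_map \<phi> x y g"
proof -
  have weight: "\<exists>v\<ge>0. \<theta> ((1 / (1 + u)) *\<^sub>R rank_one a) = (1 / (1 + v)) *\<^sub>R rank_one b"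
    if \<theta>: "ortho_order_automorphism \<theta>" "norm a = 1" "norm b = 1" "\<theta> (rank_one a) = rank_one b" and u: "0 \<le> u"
    for \<theta> and a b :: 'a and u :: real
  proof -
    have "0 < 1 / (1 + u)" "1 / (1 + u) \<le> 1" using u by simp_all
    then obtain t where t: "0 < t" "t \<le> 1" "\<theta> ((1 / (1 + u)) *\<^sub>R rank_one a) = t *\<^sub>R rank_one b"
      using automorphism_scaled_rank_one[OF \<theta>, of "1 / (1 + u)"] by metis
    then show ?thesis by (intro exI[of _ "1 / t - 1"]) simp
  qed
  obtain g where g: "\<And>u. 0 \<le> u \<Longrightarrow> 0 \<le> g u"
      "\<And>u. 0 \<le> u \<Longrightarrow> \<phi> ((1 / (1 + u)) *\<^sub>R rank_one x) = (1 / (1 + g u)) *\<^sub>R rank_one y"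
    using weight[OF \<phi> x y xy] by metis
  obtain \<psi> where \<psi>: "ortho_order_automorphism \<psi>"
    "\<And>A. A \<in> effects \<Longrightarrow> \<phi> (\<psi> A) = A" "\<And>A. A \<in> effects \<Longrightarrow> \<psi> (\<phi> A) = A"
    by (rule automorphism_inverse[OF \<phi>]) blast
  have yx: "\<psi> (rank_one y) = rank_one x" using \<psi>(3)[OF rank_one_unit_effect[OF x]] xy by simp
  have eff: "(1 / (1 + u)) *\<^sub>R rank_one z \<in> effects" if "0 \<le> u" "norm z = 1" for u and z :: 'a
    using that by (intro rank_one_effect) simp_all
  show ?thesis
    unfolding weight_map_def
  proof (intro exI[of _ g] conjI allI impI g)
    fix w :: real assume w: "0 \<le> w"
    obtain u where u: "0 \<le> u" "\<psi> ((1 / (1 + w)) *\<^sub>R rank_one y) = (1 / (1 + u)) *\<^sub>R rank_one x"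
      using weight[OF \<psi>(1) y x yx w] by blast
    then have "(1 / (1 + w)) *\<^sub>R rank_one y = (1 / (1 + g u)) *\<^sub>R rank_one y"
      using \<psi>(2)[OF eff[OF w y]] g(2)[OF u(1)] u(2) by metis
    then have "1 / (1 + w) = 1 / (1 + g u)" by (rule rank_one_scaled_inject[OF y])
    then show "\<exists>u\<ge>0. g u = w" using u(1) by auto
  next
    fix u v :: real assume uv: "0 \<le> u" "0 \<le> v"
    have "(1 / (1 + b)) *\<^sub>R rank_one z \<preceq> (1 / (1 + a)) *\<^sub>R rank_one z \<longleftrightarrow> a \<le> b"
      if "0 \<le> a" "0 \<le> b" "norm z = 1" for a b and z :: 'a
      using that by (subst rank_one_scaled_le_iff) (simp_all add: field_simps)
    from this[OF uv x] this[OF g(1)[OF uv(1)] g(1)[OF uv(2)] y]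
    show "g u \<le> g v \<longleftrightarrow> u \<le> v"
      using automorphism_le_iff[OF \<phi> eff[OF uv(2) x] eff[OF uv(1) x]] g(2) uv by simp
  qed
qed

lemma automorphism_preserves_overlap:
  fixes e f :: "'a::complex_hilbert_space"
  assumes \<phi>: "ortho_order_automorphism \<phi>"
    and ef: "norm e = 1" "norm f = 1" "cinner e f = 0"
  obtains T :: "'a \<Rightarrow> 'a" where "\<And>x. norm x = 1 \<Longrightarrow> norm (T x) = 1"
    "\<And>x y. norm x = 1 \<Longrightarrow> norm y = 1 \<Longrightarrow> overlap (T x) (T y) = overlap x y"
    "\<And>x t. norm x = 1 \<Longrightarrow> 0 < t \<Longrightarrow> t \<le> 1 \<Longrightarrow> \<phi> (t *\<^sub>R rank_one x) = t *\<^sub>R rank_one (T x)"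
    "\<And>y. norm y = 1 \<Longrightarrow> \<exists>x. norm x = 1 \<and> rank_one (T x) = rank_one y"
proof -
  have "\<exists>y. norm y = 1 \<and> \<phi> (rank_one x) = rank_one y" if "norm x = 1" for x
    using automorphism_rank_one[OF \<phi> that] by blast
  then obtain T :: "'a \<Rightarrow> 'a" where T: "\<And>x. norm x = 1 \<Longrightarrow> norm (T x) = 1"
      "\<And>x. norm x = 1 \<Longrightarrow> \<phi> (rank_one x) = rank_one (T x)"
    by metis
  obtain \<psi> where \<psi>: "ortho_order_automorphism \<psi>"
    "\<And>A. A \<in> effects \<Longrightarrow> \<phi> (\<psi> A) = A" "\<And>A. A \<in> effects \<Longrightarrow> \<psi> (\<phi> A) = A"
    by (rule automorphism_inverse[OF \<phi>]) blast
  have onto_T: "\<exists>x. norm x = 1 \<and> rank_one (T x) = rank_one y" if y: "norm y = 1" for y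
  proof -
    obtain x where x: "norm x = 1" "\<psi> (rank_one y) = rank_one x"
      using automorphism_rank_one[OF \<psi>(1) y] by blast
    then have "\<phi> (rank_one x) = rank_one y" using \<psi>(2)[OF rank_one_unit_effect[OF y]] by simp
    then show ?thesis using x T(2) by metis
  qed
  have "\<exists>g. norm x = 1 \<longrightarrow> weight_map \<phi> x (T x) g" for x
    using automorphism_weights[OF \<phi> _ T] by blast
  then obtain G where "\<And>x. norm x = 1 \<Longrightarrow> weight_map \<phi> x (T x) (G x)"
    by metis
  then have G: "\<And>x u. norm x = 1 \<Longrightarrow> 0 \<le> u \<Longrightarrow> 0 \<le> G x u"
    "\<And>x u. norm x = 1 \<Longrightarrow> 0 \<le> u \<Longrightarrow>
      \<phi> ((1 / (1 + u)) *\<^sub>R rank_one x) = (1 / (1 + G x u)) *\<^sub>R rank_one (T x)"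
    "\<And>x w. norm x = 1 \<Longrightarrow> 0 \<le> w \<Longrightarrow> \<exists>u\<ge>0. G x u = w"
    "\<And>x u v. norm x = 1 \<Longrightarrow> 0 \<le> u \<Longrightarrow> 0 \<le> v \<Longrightarrow> G x u \<le> G x v \<longleftrightarrow> u \<le> v"
    unfolding weight_map_def by blast+
  have eff: "(1 / (1 + u)) *\<^sub>R rank_one z \<in> effects" if "0 \<le> u" "norm z = 1" for u and z :: 'a
    using that by (intro rank_one_effect) simp_all
  have coexist: "overlap (T x) (T y) \<le> G x u * G y v \<longleftrightarrow> overlap x y \<le> u * v"
    if x: "norm x = 1" and y: "norm y = 1" and u: "0 \<le> u" and v: "0 \<le> v" for x y u v
  proof -
    have "\<phi> (id_blinfun - (1 / (1 + v)) *\<^sub>R rank_one y) = id_blinfun - (1 / (1 + G y v)) *\<^sub>R rank_one (T y)"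
      using automorphism_complement[OF \<phi> eff[OF v y]] G(2)[OF y v] by simp
    then show ?thesis
      using automorphism_le_iff[OF \<phi> eff[OF u x] complement_effect[OF eff[OF v y]]] G(2)[OF x u]
        rank_one_le_complement_iff[OF x y u v]
        rank_one_le_complement_iff[OF T(1)[OF x] T(1)[OF y] G(1)[OF x u] G(1)[OF y v]]
      by (simp add: overlap_def)
  qed
  have G_id: "G x u = u" if "norm x = 1" "0 \<le> u" for x u
    by (rule weights_rigid(1)[OF T(1) G(1) G(3) G(4) coexist onto_T ef]) (use that in simp_all)
  have overlap_T: "overlap (T x) (T y) = overlap x y" if "norm x = 1" "norm y = 1" for x y
    by (rule weights_rigid(2)[OF T(1) G(1) G(3) G(4) coexist onto_T ef]) (use that in simp_all)
  show thesis
  proof (rule that[OF T(1) overlap_T _ onto_T])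
    fix x :: 'a and t assume x: "norm x = 1" and t: "0 < t" "t \<le> (1::real)"
    have "\<phi> ((1 / (1 + (1 / t - 1))) *\<^sub>R rank_one x) = (1 / (1 + (1 / t - 1))) *\<^sub>R rank_one (T x)"
      using G(2)[OF x, of "1 / t - 1"] G_id[OF x, of "1 / t - 1"] t by simp
    then show "\<phi> (t *\<^sub>R rank_one x) = t *\<^sub>R rank_one (T x)" using t by simp
  qed
qed

section \<open>Effects are determined by the rank-one effects below them\<close>

text \<open>By Cauchy--Schwarz, the rank-one operator \<open>|A z\<rangle>\<langle>A z| / \<langle>A z, z\<rangle>\<close> lies below \<open>A\<close> whenever
  \<open>\<langle>A z, z\<rangle> \<noteq> 0\<close>, and its form agrees with that of \<open>A\<close> at \<open>z\<close>.\<close>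

lemma op_le_if_rank_one_below:
  assumes A: "A \<in> effects" and B: "B \<in> effects"
    and below: "\<And>x t. norm x = 1 \<Longrightarrow> 0 < t \<Longrightarrow> t \<le> 1 \<Longrightarrow> t *\<^sub>R rank_one x \<preceq> A \<Longrightarrow> t *\<^sub>R rank_one x \<preceq> B"
  shows "A \<preceq> B"
proof -
  have "inner (A z) z \<le> inner (B z) z" for z
  proof (cases "inner (A z) z = 0")
    case True
    then show ?thesis using effect_nonneg[OF B] by simp
  next
    case False
    define a where "a = inner (A z) z"
    have a: "0 < a" using False effect_nonneg[OF A, of z] by (simp add: a_def)
    have Az: "A z \<noteq> 0" using False by auto
    define t where "t = (norm (A z))\<^sup>2 / a"
    define x where "x = A z /\<^sub>R norm (A z)"
    have x: "norm x = 1" using Az by (simp add: x_def)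
    have t: "0 < t" "t \<le> 1"
      using a Az effect_norm_sq_le[OF A, of z] by (simp_all add: t_def a_def)
    have form: "inner ((t *\<^sub>R rank_one x) y) y = (cmod (cinner (A y) z))\<^sup>2 / a" for y
      using Az by (simp add: blinfun.scaleR_left rank_one_form x_def t_def cinner_scaleR_right
          norm_mult norm_divide power_mult_distrib power_divide effect_self_adjoint[OF A] field_simps)
    have eff: "t *\<^sub>R rank_one x \<in> effects" using rank_one_effect[OF x, of t] t by simp
    have "t *\<^sub>R rank_one x \<preceq> A"
    proof -
      have "(cmod (cinner (A y) z))\<^sup>2 / a \<le> inner (A y) y" for y
        using effect_Cauchy_Schwarz[OF A, of y z] a by (simp add: divide_le_eq a_def)
      then show ?thesis by (simp add: op_le_effects_iff[OF eff A] form)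
    qed
    then have "t *\<^sub>R rank_one x \<preceq> B" using below x t by blast
    then have "(cmod (cinner (A z) z))\<^sup>2 / a \<le> inner (B z) z"
      using op_le_effects_iff[OF eff B] form by metis
    moreover have "(cmod (cinner (A z) z))\<^sup>2 / a = a"
      using a by (simp add: effect_form_real[OF A] a_def[symmetric] power2_eq_square)
    ultimately show ?thesis by (simp add: a_def)
  qed
  then show ?thesis by (simp add: op_le_effects_iff[OF A B])
qed

section \<open>Implementation by a unitary or antiunitary operator\<close>

text \<open>With \<open>\<sigma>\<close> the identity or conjugation, \<open>U\<close> is unitary or antiunitary and \<open>V\<close> its inverse. Both
  \<open>\<phi> A\<close> and \<open>U A V\<close> have the images of the rank-one effects below \<open>A\<close> as the rank-one effects below
  them.\<close>

lemma implemented_if_implemented_on_rank_one: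
  fixes U V :: "'a::complex_hilbert_space \<Rightarrow>\<^sub>L 'a" and \<sigma> :: "complex \<Rightarrow> complex"
  assumes \<phi>: "ortho_order_automorphism \<phi>"
    and UV: "\<And>y. U (V y) = y" and VU: "\<And>x. V (U x) = x"
    and \<sigma>: "\<sigma> = id \<or> \<sigma> = cnj"
    and scale: "\<And>a x. U (a *\<^sub>C x) = \<sigma> a *\<^sub>C U x"
    and cinner_U: "\<And>x y. cinner (U x) (U y) = \<sigma> (cinner x y)"
    and rank_one: "\<And>x t. norm x = 1 \<Longrightarrow> 0 < t \<Longrightarrow> t \<le> 1 \<Longrightarrow>
      \<phi> (t *\<^sub>R rank_one x) = t *\<^sub>R rank_one (U x)"
    and A: "A \<in> effects"
  shows "\<phi> A = U o\<^sub>L A o\<^sub>L V"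
proof -
  let ?B = "U o\<^sub>L A o\<^sub>L V"
  have \<sigma>\<sigma>: "\<sigma> (\<sigma> a) = a" "Re (\<sigma> a) = Re a" "cmod (\<sigma> a) = cmod a" "\<sigma> (of_real r) = of_real r" for a r
    using \<sigma> by auto
  have cinner_V: "cinner (V x) (V y) = \<sigma> (cinner x y)" for x y
    using arg_cong[OF cinner_U[of "V x" "V y"], of \<sigma>] by (simp add: UV \<sigma>\<sigma>)
  have form: "cinner (?B z) z = of_real (inner (A (V z)) (V z))" for z
    using cinner_U[of "A (V z)" "V z"] by (simp add: UV effect_form_real[OF A] \<sigma>\<sigma>)
  have rform: "inner (?B z) z = inner (A (V z)) (V z)" for z
    by (simp only: inner_eq_Re_cinner[of "?B z"] form Re_complex_of_real)
  have norm_V: "norm (V z) = norm z" for z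
  proof -
    have "complex_of_real ((norm (V z))\<^sup>2) = of_real ((norm z)\<^sup>2)"
      using cinner_V[of z z] by (simp only: cinner_self \<sigma>\<sigma>)
    then have "(norm (V z))\<^sup>2 = (norm z)\<^sup>2" using of_real_eq_iff by blast
    then show ?thesis by simp
  qed
  have B: "?B \<in> effects"
  proof (rule effectI)
    show "complex_linear_op ?B"
      unfolding complex_linear_op_def
    proof (intro allI)
      fix a x
      have "V (a *\<^sub>C x) = \<sigma> a *\<^sub>C V x"
        using arg_cong[OF scale[of "\<sigma> a" "V x"], of "blinfun_apply V"] by (simp add: UV VU \<sigma>\<sigma>)
      then show "?B (a *\<^sub>C x) = a *\<^sub>C ?B x" by (simp add: effect_linear[OF A] scale \<sigma>\<sigma>)
    qed
    show "Im (cinner (?B x) x) = 0" for x by (simp only: form Im_complex_of_real)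
    show "0 \<le> inner (?B x) x" for x using rform effect_nonneg[OF A] by simp
    show "inner (?B x) x \<le> (norm x)\<^sup>2" for x
      using rform[of x] effect_le_norm_sq[OF A, of "V x"] norm_V[of x] by simp
  qed
  have same: "t *\<^sub>R rank_one x \<preceq> \<phi> A \<longleftrightarrow> t *\<^sub>R rank_one x \<preceq> ?B"
    if x: "norm x = 1" and t: "0 < t" "t \<le> 1" for x t
  proof -
    have Vx: "norm (V x) = 1" using norm_V x by simp
    have eff: "t *\<^sub>R rank_one x \<in> effects" "t *\<^sub>R rank_one (V x) \<in> effects"
      using t x Vx by (simp_all add: rank_one_effect)
    have "t *\<^sub>R rank_one x \<preceq> \<phi> A \<longleftrightarrow> t *\<^sub>R rank_one (V x) \<preceq> A"
      using automorphism_le_iff[OF \<phi> eff(2) A] rank_one[OF Vx t] by (simp add: UV)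
    also have "\<dots> \<longleftrightarrow> (\<forall>z. t * (cmod (cinner z (V x)))\<^sup>2 \<le> inner (A z) z)"
      by (simp add: op_le_effects_iff[OF eff(2) A] blinfun.scaleR_left rank_one_form)
    also have "\<dots> \<longleftrightarrow> (\<forall>z. t * (cmod (cinner (V z) (V x)))\<^sup>2 \<le> inner (A (V z)) (V z))"
      using VU by metis
    also have "\<dots> \<longleftrightarrow> t *\<^sub>R rank_one x \<preceq> ?B"
      unfolding op_le_effects_iff[OF eff(1) B] rform
      by (simp add: blinfun.scaleR_left rank_one_form cinner_V \<sigma>\<sigma>)
    finally show ?thesis .
  qed
  have \<phi>A: "\<phi> A \<in> effects" using automorphism_effect[OF \<phi> A] .
  show ?thesis
  proof (rule op_le_antisym[OF \<phi>A B])
    show "\<phi> A \<preceq> ?B" by (rule op_le_if_rank_one_below[OF \<phi>A B]) (simp add: same)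
    show "?B \<preceq> \<phi> A" by (rule op_le_if_rank_one_below[OF B \<phi>A]) (simp add: same)
  qed
qed

lemma isometry_inverse:
  fixes U :: "'a::real_normed_vector \<Rightarrow>\<^sub>L 'a"
  assumes surj: "surj (blinfun_apply U)" and norm: "\<And>x. norm (U x) = norm x"
  obtains V :: "'a \<Rightarrow>\<^sub>L 'a" where "\<And>y. U (V y) = y" "\<And>x. V (U x) = x"
proof -
  have inj: "inj (blinfun_apply U)"
  proof (rule injI)
    fix x y assume "U x = U y"
    then show "x = y" using norm[of "x - y"] by (simp add: blinfun.diff_right)
  qed
  let ?V = "inv (blinfun_apply U)"
  have UV: "U (?V y) = y" for y using surj by (rule surj_f_inv_f)
  have VU: "?V (U x) = x" for x using inj by (rule inv_f_f)
  have "bounded_linear ?V"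
  proof (rule bounded_linear_intro[where K = 1])
    show "?V (x + y) = ?V x + ?V y" for x y
      using VU[of "?V x + ?V y"] by (simp add: blinfun.add_right UV)
    show "?V (r *\<^sub>R x) = r *\<^sub>R ?V x" for r x
      using VU[of "r *\<^sub>R ?V x"] by (simp add: blinfun.scaleR_right UV)
    show "norm (?V x) \<le> norm x * 1" for x
      using norm[of "?V x"] by (simp add: UV)
  qed
  then show thesis using that[of "Blinfun ?V"] UV VU by (simp add: bounded_linear_Blinfun_apply)
qed

lemma two_dimensional_orthonormal_pair:
  assumes "cdim_at_least 2 TYPE('a::complex_hilbert_space)"
  obtains e f :: "'a::complex_hilbert_space" where "norm e = 1" "norm f = 1" "cinner e f = 0"
proof -
  interpret vector_space "scaleC :: complex \<Rightarrow> 'a \<Rightarrow> 'a" by (rule vector_space_scaleC)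
  obtain S :: "'a set" where S: "finite S" "card S = 2" "independent S"
    using assms unfolding cdim_at_least_def by blast
  then obtain a b where ab: "S = {a, b}" "a \<noteq> b" by (meson card_2_iff)
  have a: "a \<noteq> 0" using S ab dependent_zero by blast
  have "b \<notin> span {a}"
    using S(3) ab by (metis dependent_def insert_commute insert_iff Diff_insert_absorb insert_Diff_single singletonD)
  then have b: "b - c *\<^sub>C a \<noteq> 0" for c
    by (metis eq_iff_diff_eq_0 span_base span_scale singletonI)
  define e where "e = a /\<^sub>R norm a"
  have e: "norm e = 1" using a by (simp add: e_def)
  define d where "d = b - cinner b e *\<^sub>C e"
  have "d \<noteq> 0"
    using b[of "cinner b e * of_real (inverse (norm a))"] by (simp add: d_def e_def scaleR_scaleC scaleC_scaleC)
  have "cinner e d = 0"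
    using cinner_commute[of e b] cinner_self[of e] e by (simp add: d_def cinner_expand)
  then show thesis
    using that[of e "d /\<^sub>R norm d"] e \<open>d \<noteq> 0\<close> by (simp add: cinner_scaleR_right)
qed

lemma rank_one_eq_imp_phase:
  assumes "norm x = 1" "norm y = 1" "rank_one x = rank_one y"
  obtains a where "cmod a = 1" "y = a *\<^sub>C x"
proof -
  have "y = rank_one y y" using assms by (simp add: rank_one_apply cinner_self scaleC_one)
  also have "\<dots> = cinner y x *\<^sub>C x" by (simp add: assms(3)[symmetric] rank_one_apply)
  finally have y: "y = cinner y x *\<^sub>C x" .
  then have "cmod (cinner y x) = 1" using assms norm_scaleC[of "cinner y x" x] by simp
  then show thesis using y that by blast
qed

lemma automorphism_implemented:
  fixes \<phi> :: "('a::complex_hilbert_space \<Rightarrow>\<^sub>L 'a) \<Rightarrow> ('a \<Rightarrow>\<^sub>L 'a)"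
  assumes dim: "cdim_at_least 2 TYPE('a)" and \<phi>: "ortho_order_automorphism \<phi>"
  obtains U V where "\<And>x. blinfun_apply V (blinfun_apply U x) = x" "\<And>A. A \<in> effects \<Longrightarrow> \<phi> A = U o\<^sub>L A o\<^sub>L V"
    "unitary_op U \<and> adjoint_op U = V \<or> antiunitary_op U \<and> conjugate_adjoint_op U = V"
proof -
  obtain e f :: 'a where ef: "norm e = 1" "norm f = 1" "cinner e f = 0"
    using two_dimensional_orthonormal_pair[OF dim] by blast
  obtain T :: "'a \<Rightarrow> 'a" where T: "\<And>x. norm x = 1 \<Longrightarrow> norm (T x) = 1"
    "\<And>x y. norm x = 1 \<Longrightarrow> norm y = 1 \<Longrightarrow> overlap (T x) (T y) = overlap x y"
    "\<And>x t. norm x = 1 \<Longrightarrow> 0 < t \<Longrightarrow> t \<le> 1 \<Longrightarrow> \<phi> (t *\<^sub>R rank_one x) = t *\<^sub>R rank_one (T x)"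
    "\<And>y. norm y = 1 \<Longrightarrow> \<exists>x. norm x = 1 \<and> rank_one (T x) = rank_one y"
    by (rule automorphism_preserves_overlap[OF \<phi> ef]) blast
  \<comment> \<open>\<open>T\<close> is meaningful on unit vectors only; Wigner's theorem is applied to its homogeneous
    extension.\<close>
  define T' where "T' = (\<lambda>x. norm x *\<^sub>R T (x /\<^sub>R norm x))"
  have T'_cinner: "cmod (cinner (T' x) (T' y)) = cmod (cinner x y)" for x y
  proof (cases "x = 0 \<or> y = 0")
    case False
    then have "overlap (T (x /\<^sub>R norm x)) (T (y /\<^sub>R norm y)) = overlap (x /\<^sub>R norm x) (y /\<^sub>R norm y)"
      by (intro T) simp_all
    then have "cmod (cinner (T (x /\<^sub>R norm x)) (T (y /\<^sub>R norm y))) = cmod (cinner (x /\<^sub>R norm x) (y /\<^sub>R norm y))"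
      by (simp add: overlap_def)
    then show ?thesis
      using False by (simp add: T'_def cinner_expand norm_mult norm_inverse) (simp add: field_simps)
  qed (auto simp: T'_def)
  have T'_surj: "\<exists>x a. cmod a = 1 \<and> y = a *\<^sub>C T' x" for y
  proof (cases "y = 0")
    case True
    then show ?thesis by (intro exI[of _ 0] exI[of _ 1]) (simp add: T'_def)
  next
    case False
    define w where "w = y /\<^sub>R norm y"
    have w: "norm w = 1" using False by (simp add: w_def)
    obtain x where x: "norm x = 1" "rank_one (T x) = rank_one w" using T(4)[OF w] by blast
    obtain a where a: "cmod a = 1" "w = a *\<^sub>C T x"
      using rank_one_eq_imp_phase[OF T(1)[OF x(1)] w x(2)] by blast
    have "y = norm y *\<^sub>R w" using False by (simp add: w_def)
    also have "\<dots> = a *\<^sub>C norm y *\<^sub>R T x"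
      by (simp add: a scaleR_scaleC scaleC_scaleC mult.commute)
    also have "norm y *\<^sub>R T x = T' (norm y *\<^sub>R x)"
      using False x(1) by (simp add: T'_def)
    finally show ?thesis using a(1) by blast
  qed
  obtain U where U: "unitary_op U \<or> antiunitary_op U"
    "\<And>x. \<exists>a. cmod a = 1 \<and> blinfun_apply U x = a *\<^sub>C T' x"
    using Wigner[OF T'_cinner T'_surj ef(1)] by blast
  have rank_one: "\<phi> (t *\<^sub>R rank_one x) = t *\<^sub>R rank_one (U x)"
    if "norm x = 1" "0 < t" "t \<le> 1" for x t
  proof -
    obtain a where a: "cmod a = 1" "U x = a *\<^sub>C T' x" using U(2) by blast
    then have "rank_one (U x) = rank_one (T x)" using that by (simp add: T'_def rank_one_scaleC)
    then show ?thesis using T(3)[OF that] by simp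
  qed
  obtain \<sigma> where \<sigma>: "\<sigma> = id \<and> unitary_op U \<or> \<sigma> = cnj \<and> antiunitary_op U"
    using U(1) by blast
  then have scale: "U (a *\<^sub>C x) = \<sigma> a *\<^sub>C U x" and cinner_U: "cinner (U x) (U y) = \<sigma> (cinner x y)"
    and surj: "surj (blinfun_apply U)" for a x y
    by (auto simp: unitary_op_def antiunitary_op_def complex_linear_op_def conjugate_linear_op_def)
  have "norm (U x) = norm x" for x
  proof -
    have "(norm (U x))\<^sup>2 = cmod (cinner (U x) (U x))" by (simp add: cinner_self norm_power)
    also have "\<dots> = cmod (cinner x x)" unfolding cinner_U using \<sigma> by auto
    also have "\<dots> = (norm x)\<^sup>2" by (simp add: cinner_self norm_power)
    finally show ?thesis by simp
  qed
  with surj obtain V :: "'a \<Rightarrow>\<^sub>L 'a" where UV: "\<And>y. U (V y) = y" and VU: "\<And>x. V (U x) = x"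
    by (rule isometry_inverse) blast
  show thesis
  proof (rule that[OF VU])
    show "\<phi> A = U o\<^sub>L A o\<^sub>L V" if "A \<in> effects" for A
      by (rule implemented_if_implemented_on_rank_one[OF \<phi> UV VU _ scale cinner_U rank_one that])
         (use \<sigma> in auto)
    have adj: "cinner (U x) y = \<sigma> (cinner x (V y))" for x y
      using cinner_U[of x "V y"] by (simp add: UV)
    from \<sigma> show "unitary_op U \<and> adjoint_op U = V \<or> antiunitary_op U \<and> conjugate_adjoint_op U = V"
    proof
      assume *: "\<sigma> = id \<and> unitary_op U"
      then have "adjoint_op U = V" by (intro adjoint_op_eqI) (simp add: adj)
      with * show ?thesis by simp
    next
      assume *: "\<sigma> = cnj \<and> antiunitary_op U"
      then have "conjugate_adjoint_op U = V" by (intro conjugate_adjoint_op_eqI) (simp add: adj)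
      with * show ?thesis by simp
    qed
  qed
qed

theorem corollary6:
  fixes \<phi> :: "('a::complex_hilbert_space \<Rightarrow>\<^sub>L 'a) \<Rightarrow> ('a \<Rightarrow>\<^sub>L 'a)"
  assumes "cdim_at_least 2 TYPE('a)"
    and "ortho_order_automorphism \<phi>"
  shows "(\<forall>A\<in>effects. \<forall>B\<in>effects. A \<preceq> B \<longleftrightarrow> \<phi> A \<preceq> \<phi> B) \<and>
    (\<forall>A\<in>effects. \<forall>B\<in>effects. A o\<^sub>L B = 0 \<longleftrightarrow> \<phi> A o\<^sub>L \<phi> B = 0) \<and>
    (\<exists>U :: 'a \<Rightarrow>\<^sub>L 'a.
       unitary_op U \<and> (\<forall>A\<in>effects. \<phi> A = U o\<^sub>L A o\<^sub>L adjoint_op U) \<or>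
       antiunitary_op U \<and> (\<forall>A\<in>effects. \<phi> A = U o\<^sub>L A o\<^sub>L conjugate_adjoint_op U))"
proof -
  obtain U V :: "'a \<Rightarrow>\<^sub>L 'a" where VU: "\<And>x. V (U x) = x"
    and impl: "\<And>A. A \<in> effects \<Longrightarrow> \<phi> A = U o\<^sub>L A o\<^sub>L V"
    and U: "unitary_op U \<and> adjoint_op U = V \<or> antiunitary_op U \<and> conjugate_adjoint_op U = V"
    using automorphism_implemented[OF assms] by metis
  have "A o\<^sub>L B = 0 \<longleftrightarrow> \<phi> A o\<^sub>L \<phi> B = 0" if A: "A \<in> effects" and B: "B \<in> effects" for A B
  proof -
    have product: "\<phi> A (\<phi> B x) = U (A (B (V x)))" for x
      by (simp add: impl[OF A] impl[OF B] VU)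
    show ?thesis
    proof
      assume "A o\<^sub>L B = 0"
      then have "A (B x) = 0" for x by (metis blinfun_apply_blinfun_compose zero_blinfun.rep_eq)
      then show "\<phi> A o\<^sub>L \<phi> B = 0" by (intro blinfun_eqI) (simp add: product)
    next
      assume "\<phi> A o\<^sub>L \<phi> B = 0"
      then have "\<phi> A (\<phi> B x) = 0" for x
        by (metis blinfun_apply_blinfun_compose zero_blinfun.rep_eq)
      then have "U (A (B x)) = 0" for x using product[of "U x"] by (simp add: VU)
      then have "A (B x) = 0" for x using VU[of "A (B x)"] by simp
      then show "A o\<^sub>L B = 0" by (intro blinfun_eqI) simp
    qed
  qed
  moreover have "A \<preceq> B \<longleftrightarrow> \<phi> A \<preceq> \<phi> B" if "A \<in> effects" "B \<in> effects" for A B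
    using automorphism_le_iff[OF assms(2) that] by simp
  ultimately show ?thesis using U impl by blast
qed

end
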